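(* For every integer $d>2$, the Euler characteristic of $M_{d,\ast}$ is zero, i.e. $\sum_{n\ge 1}(-1)^n\dim_{\mathbb{Q}}M_{d,n}=0$.
   Context: $\mathcal{B}^o_n$ is the Lie algebra over $\mathbb{Q}$ generated by classes $x_{ij}$, $1\le i,j\le n$, with relations (1) $x_{ij}=x_{ji}$; (2) $x_{ii}=0$; (3) $[x_{ij},x_{\ell m}]=0$ if $\{i,j\}\cap\{\ell,m\}=\emptyset$; (4) $[x_{ij},x_{j\ell}]=[x_{j\ell},x_{\ell i}]=[x_{\ell i},x_{ij}]$. It is graded by the number of generators appearing in a bracket. For $n>1$, the subalgebra of $\mathcal{B}^o_n$ generated by $x_{1n},\dots,x_{n-1,n}$ is a free Lie algebra on these $n-1$ generators. For $n>1$ and $d\ge 1$, $M_{d,n}$ is the subspace of the degree $d$ summand of $\mathcal{B}^o_n$ spanned by (iterated, degree $d$) brackets of the classes $x_{in}$, $1\le i\le n-1$, such that each $i$ from $1$ to $n-1$ appears as an index. For $n=1$, $M_{d,1}=0$ when $d>1$. Each $M_{d,n}$ is finite-dimensional, and $M_{d,n}=0$ for $n>d+1$. The complex $M_{d,\ast}$ has $M_{d,n}$ in degree $n$ (these complexes are the rows of the $E^1$ term, for $k$ odd, of a spectral sequence converging to the rational homotopy groups of a space of long knots in $\mathbb{R}^k\times I$); its Euler characteristic is the alternating sum of the dimensions of the $M_{d,n}$. *)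

theory Defs
  imports "Jordan_Normal_Form.VS_Connect"
begin

section \<open>Lie algebras over a field\<close>

text \<open>The record of HOL-Algebra modules has a multiplication and a unit. Here the
  multiplication holds the Lie bracket, and the unit is never used.\<close>

locale lie_algebra = vectorspace K L for K and L (structure) +
  assumes bracket_closed:
      "\<lbrakk>x \<in> carrier L; y \<in> carrier L\<rbrakk> \<Longrightarrow> x \<otimes> y \<in> carrier L"
    and bracket_add_left:
      "\<lbrakk>x \<in> carrier L; y \<in> carrier L; z \<in> carrier L\<rbrakk> \<Longrightarrow> (x \<oplus> y) \<otimes> z = x \<otimes> z \<oplus> y \<otimes> z"
    and bracket_add_right:
      "\<lbrakk>x \<in> carrier L; y \<in> carrier L; z \<in> carrier L\<rbrakk> \<Longrightarrow> x \<otimes> (y \<oplus> z) = x \<otimes> y \<oplus> x \<otimes> z"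
    and bracket_smult_left:
      "\<lbrakk>c \<in> carrier K; x \<in> carrier L; y \<in> carrier L\<rbrakk> \<Longrightarrow> (c \<odot> x) \<otimes> y = c \<odot> (x \<otimes> y)"
    and bracket_smult_right:
      "\<lbrakk>c \<in> carrier K; x \<in> carrier L; y \<in> carrier L\<rbrakk> \<Longrightarrow> x \<otimes> (c \<odot> y) = c \<odot> (x \<otimes> y)"
    and bracket_self: "x \<in> carrier L \<Longrightarrow> x \<otimes> x = \<zero>"
    and jacobi:
      "\<lbrakk>x \<in> carrier L; y \<in> carrier L; z \<in> carrier L\<rbrakk> \<Longrightarrow>
        x \<otimes> (y \<otimes> z) \<oplus> (y \<otimes> (z \<otimes> x) \<oplus> z \<otimes> (x \<otimes> y)) = \<zero>"


section \<open>Rational Lie algebras given by generators and relations\<close>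

datatype 'g lie_term =
    Gen 'g
  | Zero
  | Add "'g lie_term" "'g lie_term"
  | Scale rat "'g lie_term"
  | Bracket "'g lie_term" "'g lie_term"

definition lie_terms :: "'g set \<Rightarrow> 'g lie_term set" where
  "lie_terms X = {t. set_lie_term t \<subseteq> X}"

text \<open>The least congruence on the terms over the generators \<open>X\<close> that contains the
  relations \<open>R\<close> and the axioms of a rational Lie algebra. A pair \<open>(s, t)\<close> in \<open>R\<close> stands for
  the relation \<open>s = t\<close>.\<close>

inductive lie_eq :: "'g set \<Rightarrow> ('g lie_term \<times> 'g lie_term) set \<Rightarrow> 'g lie_term \<Rightarrow> 'g lie_term \<Rightarrow> bool"
  for X :: "'g set" and R :: "('g lie_term \<times> 'g lie_term) set" where
  rel: "\<lbrakk>(s, t) \<in> R; s \<in> lie_terms X; t \<in> lie_terms X\<rbrakk> \<Longrightarrow> lie_eq X R s t"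
| refl: "t \<in> lie_terms X \<Longrightarrow> lie_eq X R t t"
| sym: "lie_eq X R s t \<Longrightarrow> lie_eq X R t s"
| trans: "\<lbrakk>lie_eq X R s t; lie_eq X R t u\<rbrakk> \<Longrightarrow> lie_eq X R s u"
| add_cong: "\<lbrakk>lie_eq X R s s'; lie_eq X R t t'\<rbrakk> \<Longrightarrow> lie_eq X R (Add s t) (Add s' t')"
| scale_cong: "lie_eq X R s s' \<Longrightarrow> lie_eq X R (Scale c s) (Scale c s')"
| bracket_cong: "\<lbrakk>lie_eq X R s s'; lie_eq X R t t'\<rbrakk> \<Longrightarrow> lie_eq X R (Bracket s t) (Bracket s' t')"
| add_assoc: "\<lbrakk>s \<in> lie_terms X; t \<in> lie_terms X; u \<in> lie_terms X\<rbrakk> \<Longrightarrow>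
    lie_eq X R (Add (Add s t) u) (Add s (Add t u))"
| add_comm: "\<lbrakk>s \<in> lie_terms X; t \<in> lie_terms X\<rbrakk> \<Longrightarrow> lie_eq X R (Add s t) (Add t s)"
| add_zero: "t \<in> lie_terms X \<Longrightarrow> lie_eq X R (Add Zero t) t"
| add_neg: "t \<in> lie_terms X \<Longrightarrow> lie_eq X R (Add (Scale (-1) t) t) Zero"
| scale_add: "\<lbrakk>s \<in> lie_terms X; t \<in> lie_terms X\<rbrakk> \<Longrightarrow>
    lie_eq X R (Scale c (Add s t)) (Add (Scale c s) (Scale c t))"
| add_scale: "t \<in> lie_terms X \<Longrightarrow> lie_eq X R (Scale (b + c) t) (Add (Scale b t) (Scale c t))"
| scale_scale: "t \<in> lie_terms X \<Longrightarrow> lie_eq X R (Scale (b * c) t) (Scale b (Scale c t))"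
| scale_one: "t \<in> lie_terms X \<Longrightarrow> lie_eq X R (Scale 1 t) t"
| bracket_add_left: "\<lbrakk>s \<in> lie_terms X; t \<in> lie_terms X; u \<in> lie_terms X\<rbrakk> \<Longrightarrow>
    lie_eq X R (Bracket (Add s t) u) (Add (Bracket s u) (Bracket t u))"
| bracket_add_right: "\<lbrakk>s \<in> lie_terms X; t \<in> lie_terms X; u \<in> lie_terms X\<rbrakk> \<Longrightarrow>
    lie_eq X R (Bracket s (Add t u)) (Add (Bracket s t) (Bracket s u))"
| bracket_scale_left: "\<lbrakk>s \<in> lie_terms X; t \<in> lie_terms X\<rbrakk> \<Longrightarrow>
    lie_eq X R (Bracket (Scale c s) t) (Scale c (Bracket s t))"
| bracket_scale_right: "\<lbrakk>s \<in> lie_terms X; t \<in> lie_terms X\<rbrakk> \<Longrightarrow>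
    lie_eq X R (Bracket s (Scale c t)) (Scale c (Bracket s t))"
| bracket_self: "t \<in> lie_terms X \<Longrightarrow> lie_eq X R (Bracket t t) Zero"
| jacobi: "\<lbrakk>s \<in> lie_terms X; t \<in> lie_terms X; u \<in> lie_terms X\<rbrakk> \<Longrightarrow>
    lie_eq X R (Add (Bracket s (Bracket t u)) (Add (Bracket t (Bracket u s)) (Bracket u (Bracket s t)))) Zero"

definition lie_rel :: "'g set \<Rightarrow> ('g lie_term \<times> 'g lie_term) set \<Rightarrow> ('g lie_term \<times> 'g lie_term) set"
  where "lie_rel X R = {(s, t). lie_eq X R s t}"

definition lie_class :: "'g set \<Rightarrow> ('g lie_term \<times> 'g lie_term) set \<Rightarrow> 'g lie_term \<Rightarrow> 'g lie_term set"
  where "lie_class X R t = lie_rel X R `` {t}"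

definition presented_lie :: "'g set \<Rightarrow> ('g lie_term \<times> 'g lie_term) set \<Rightarrow> (rat, 'g lie_term set) module"
  where "presented_lie X R =
    \<lparr>carrier = lie_terms X // lie_rel X R,
     mult = (\<lambda>A B. \<Union>a\<in>A. \<Union>b\<in>B. lie_class X R (Bracket a b)),
     one = lie_class X R Zero,
     zero = lie_class X R Zero,
     add = (\<lambda>A B. \<Union>a\<in>A. \<Union>b\<in>B. lie_class X R (Add a b)),
     smult = (\<lambda>c A. \<Union>a\<in>A. lie_class X R (Scale c a))\<rparr>"

lemma lie_terms_simps [simp]:
  "Gen g \<in> lie_terms X \<longleftrightarrow> g \<in> X"
  "Zero \<in> lie_terms X"
  "Add s t \<in> lie_terms X \<longleftrightarrow> s \<in> lie_terms X \<and> t \<in> lie_terms X"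
  "Scale c t \<in> lie_terms X \<longleftrightarrow> t \<in> lie_terms X"
  "Bracket s t \<in> lie_terms X \<longleftrightarrow> s \<in> lie_terms X \<and> t \<in> lie_terms X"
  by (auto simp: lie_terms_def)

lemma lie_eq_terms: "lie_eq X R s t \<Longrightarrow> s \<in> lie_terms X \<and> t \<in> lie_terms X"
  by (induction rule: lie_eq.induct) auto

lemma equiv_lie_rel: "equiv (lie_terms X) (lie_rel X R)"
  by (rule equivI)
     (auto simp: lie_rel_def refl_on_def sym_def trans_def
        intro: lie_eq.refl lie_eq.sym lie_eq.trans dest: lie_eq_terms)

lemma lie_class_eq_iff:
  "\<lbrakk>s \<in> lie_terms X; t \<in> lie_terms X\<rbrakk> \<Longrightarrow> lie_class X R s = lie_class X R t \<longleftrightarrow> lie_eq X R s t"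
  using eq_equiv_class_iff[OF equiv_lie_rel, of s X t R] by (simp add: lie_class_def lie_rel_def)

lemma lie_classI: "lie_eq X R s t \<Longrightarrow> lie_class X R s = lie_class X R t"
  using lie_class_eq_iff lie_eq_terms by blast

lemma carrier_presented_lie: "carrier (presented_lie X R) = lie_class X R ` lie_terms X"
  by (auto simp: presented_lie_def quotient_def lie_class_def)

lemma presented_lie_ops:
  assumes s: "s \<in> lie_terms X" and t: "t \<in> lie_terms X"
  shows "add (presented_lie X R) (lie_class X R s) (lie_class X R t) = lie_class X R (Add s t)"
    and "mult (presented_lie X R) (lie_class X R s) (lie_class X R t) = lie_class X R (Bracket s t)"
    and "smult (presented_lie X R) c (lie_class X R s) = lie_class X R (Scale c s)"
proof -
  have self: "u \<in> lie_class X R u" if "u \<in> lie_terms X" for u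
    using that by (simp add: lie_class_def lie_rel_def lie_eq.refl)
  have eq: "lie_eq X R a u" if "a \<in> lie_class X R u" for a u
    using that by (simp add: lie_class_def lie_rel_def lie_eq.sym)
  have binop: "(\<Union>a\<in>lie_class X R s. \<Union>b\<in>lie_class X R t. lie_class X R (F a b)) = lie_class X R (F s t)"
    if "\<And>a b. lie_eq X R a s \<Longrightarrow> lie_eq X R b t \<Longrightarrow> lie_eq X R (F a b) (F s t)" for F
  proof -
    have "(\<Union>b\<in>lie_class X R t. lie_class X R (F a b)) = lie_class X R (F s t)"
      if a: "a \<in> lie_class X R s" for a
    proof (rule SUP_eq_const)
      show "lie_class X R t \<noteq> {}" using self[OF t] by auto
      show "lie_class X R (F a b) = lie_class X R (F s t)" if "b \<in> lie_class X R t" for b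
        by (rule lie_classI) (rule \<open>\<And>a b. lie_eq X R a s \<Longrightarrow> lie_eq X R b t \<Longrightarrow> lie_eq X R (F a b) (F s t)\<close>[OF eq[OF a] eq[OF that]])
    qed
    moreover have "lie_class X R s \<noteq> {}" using self[OF s] by auto
    ultimately show ?thesis by (rule SUP_eq_const[rotated])
  qed
  show "add (presented_lie X R) (lie_class X R s) (lie_class X R t) = lie_class X R (Add s t)"
    using binop[OF lie_eq.add_cong] by (simp add: presented_lie_def)
  show "mult (presented_lie X R) (lie_class X R s) (lie_class X R t) = lie_class X R (Bracket s t)"
    using binop[OF lie_eq.bracket_cong] by (simp add: presented_lie_def)
  have "(\<Union>a\<in>lie_class X R s. lie_class X R (Scale c a)) = lie_class X R (Scale c s)"
    using self[OF s] by (intro SUP_eq_const lie_classI lie_eq.scale_cong eq) auto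
  then show "smult (presented_lie X R) c (lie_class X R s) = lie_class X R (Scale c s)"
    by (simp add: presented_lie_def)
qed

lemma zero_presented_lie: "\<zero>\<^bsub>presented_lie X R\<^esub> = lie_class X R Zero"
  by (simp add: presented_lie_def)

lemmas lie_class_axioms =
  lie_eq.add_assoc[THEN lie_classI] lie_eq.add_comm[THEN lie_classI]
  lie_eq.add_zero[THEN lie_classI] lie_eq.add_neg[THEN lie_classI]
  lie_eq.scale_add[THEN lie_classI] lie_eq.add_scale[THEN lie_classI]
  lie_eq.scale_scale[THEN lie_classI] lie_eq.scale_one[THEN lie_classI]
  lie_eq.bracket_add_left[THEN lie_classI] lie_eq.bracket_add_right[THEN lie_classI]
  lie_eq.bracket_scale_left[THEN lie_classI] lie_eq.bracket_scale_right[THEN lie_classI]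
  lie_eq.bracket_self[THEN lie_classI] lie_eq.jacobi[THEN lie_classI]

lemma lie_algebra_presented_lie: "lie_algebra class_ring (presented_lie X R)"
proof -
  let ?L = "presented_lie X R" and ?C = "lie_class X R"
  note ops = presented_lie_ops zero_presented_lie
  have carrierE: "\<exists>t\<in>lie_terms X. v = ?C t" if "v \<in> carrier ?L" for v
    using that by (auto simp: carrier_presented_lie)
  have carrierI: "?C t \<in> carrier ?L" if "t \<in> lie_terms X" for t
    using that by (auto simp: carrier_presented_lie)
  have closed: "u \<oplus>\<^bsub>?L\<^esub> v \<in> carrier ?L" "c \<odot>\<^bsub>?L\<^esub> u \<in> carrier ?L" "u \<otimes>\<^bsub>?L\<^esub> v \<in> carrier ?L"
    if "u \<in> carrier ?L" "v \<in> carrier ?L" for u v c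
    using that carrierI by (auto dest!: carrierE simp: ops)
  have grp: "abelian_group ?L"
  proof (rule abelian_groupI)
    fix u v w assume uvw: "u \<in> carrier ?L" "v \<in> carrier ?L" "w \<in> carrier ?L"
    from uvw obtain r s t where "r \<in> lie_terms X" "s \<in> lie_terms X" "t \<in> lie_terms X"
      "u = ?C r" "v = ?C s" "w = ?C t" using carrierE by metis
    then show "u \<oplus>\<^bsub>?L\<^esub> v \<oplus>\<^bsub>?L\<^esub> w = u \<oplus>\<^bsub>?L\<^esub> (v \<oplus>\<^bsub>?L\<^esub> w)"
      by (simp add: ops lie_class_axioms(1))
  next
    fix u v assume "u \<in> carrier ?L" "v \<in> carrier ?L"
    then obtain s t where "s \<in> lie_terms X" "t \<in> lie_terms X" "u = ?C s" "v = ?C t"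
      using carrierE by metis
    then show "u \<oplus>\<^bsub>?L\<^esub> v = v \<oplus>\<^bsub>?L\<^esub> u" by (simp add: ops lie_class_axioms(2))
  next
    fix u assume "u \<in> carrier ?L"
    then obtain t where t: "t \<in> lie_terms X" "u = ?C t" using carrierE by metis
    then show "\<zero>\<^bsub>?L\<^esub> \<oplus>\<^bsub>?L\<^esub> u = u" by (simp add: ops lie_class_axioms(3))
    have "?C (Scale (-1) t) \<oplus>\<^bsub>?L\<^esub> u = \<zero>\<^bsub>?L\<^esub>"
      using t by (simp add: ops lie_class_axioms(4))
    then show "\<exists>y\<in>carrier ?L. y \<oplus>\<^bsub>?L\<^esub> u = \<zero>\<^bsub>?L\<^esub>"
      using t carrierI[of "Scale (-1) t"] by auto
  qed (simp_all add: closed zero_presented_lie carrierI)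
  have fld: "field (class_ring :: rat ring)" by (rule class_field.field_axioms)
  then have crng: "cring (class_ring :: rat ring)"
    by (rule field.axioms(1)[THEN domain.axioms(1)])
  have "module class_ring ?L"
  proof (rule moduleI[OF crng grp])
    fix b c :: rat and u v assume "u \<in> carrier ?L" "v \<in> carrier ?L"
    then obtain s t where "s \<in> lie_terms X" "t \<in> lie_terms X" "u = ?C s" "v = ?C t"
      using carrierE by metis
    then show "c \<odot>\<^bsub>?L\<^esub> (u \<oplus>\<^bsub>?L\<^esub> v) = c \<odot>\<^bsub>?L\<^esub> u \<oplus>\<^bsub>?L\<^esub> c \<odot>\<^bsub>?L\<^esub> v"
      by (simp add: ops lie_class_axioms(5))
  next
    fix b c :: rat and u assume "u \<in> carrier ?L"
    then obtain t where "t \<in> lie_terms X" "u = ?C t" using carrierE by metis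
    then show "(b \<oplus>\<^bsub>class_ring\<^esub> c) \<odot>\<^bsub>?L\<^esub> u = b \<odot>\<^bsub>?L\<^esub> u \<oplus>\<^bsub>?L\<^esub> c \<odot>\<^bsub>?L\<^esub> u"
      and "(b \<otimes>\<^bsub>class_ring\<^esub> c) \<odot>\<^bsub>?L\<^esub> u = b \<odot>\<^bsub>?L\<^esub> (c \<odot>\<^bsub>?L\<^esub> u)"
      and "\<one>\<^bsub>class_ring\<^esub> \<odot>\<^bsub>?L\<^esub> u = u"
      by (simp_all add: ops lie_class_axioms(6-8))
  qed (simp add: closed)
  with fld have vs: "vectorspace class_ring ?L" by (simp add: vectorspace_def)
  show ?thesis
  proof (intro lie_algebra.intro lie_algebra_axioms.intro)
    fix u v w assume "u \<in> carrier ?L" "v \<in> carrier ?L" "w \<in> carrier ?L"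
    then obtain r s t where "r \<in> lie_terms X" "s \<in> lie_terms X" "t \<in> lie_terms X"
      "u = ?C r" "v = ?C s" "w = ?C t" using carrierE by metis
    then show "(u \<oplus>\<^bsub>?L\<^esub> v) \<otimes>\<^bsub>?L\<^esub> w = u \<otimes>\<^bsub>?L\<^esub> w \<oplus>\<^bsub>?L\<^esub> v \<otimes>\<^bsub>?L\<^esub> w"
      and "u \<otimes>\<^bsub>?L\<^esub> (v \<oplus>\<^bsub>?L\<^esub> w) = u \<otimes>\<^bsub>?L\<^esub> v \<oplus>\<^bsub>?L\<^esub> u \<otimes>\<^bsub>?L\<^esub> w"
      and "u \<otimes>\<^bsub>?L\<^esub> (v \<otimes>\<^bsub>?L\<^esub> w) \<oplus>\<^bsub>?L\<^esub> (v \<otimes>\<^bsub>?L\<^esub> (w \<otimes>\<^bsub>?L\<^esub> u) \<oplus>\<^bsub>?L\<^esub> w \<otimes>\<^bsub>?L\<^esub> (u \<otimes>\<^bsub>?L\<^esub> v)) = \<zero>\<^bsub>?L\<^esub>"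
      by (simp_all add: ops lie_class_axioms(9,10,14))
  next
    fix c :: rat and u v assume "u \<in> carrier ?L" "v \<in> carrier ?L"
    then obtain s t where "s \<in> lie_terms X" "t \<in> lie_terms X" "u = ?C s" "v = ?C t"
      using carrierE by metis
    then show "(c \<odot>\<^bsub>?L\<^esub> u) \<otimes>\<^bsub>?L\<^esub> v = c \<odot>\<^bsub>?L\<^esub> (u \<otimes>\<^bsub>?L\<^esub> v)"
      and "u \<otimes>\<^bsub>?L\<^esub> (c \<odot>\<^bsub>?L\<^esub> v) = c \<odot>\<^bsub>?L\<^esub> (u \<otimes>\<^bsub>?L\<^esub> v)"
      by (simp_all add: ops lie_class_axioms(11,12))
  next
    fix u assume "u \<in> carrier ?L"
    then obtain t where "t \<in> lie_terms X" "u = ?C t" using carrierE by metis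
    then show "u \<otimes>\<^bsub>?L\<^esub> u = \<zero>\<^bsub>?L\<^esub>" by (simp add: ops lie_class_axioms(13))
  qed (simp_all add: closed vs)
qed


section \<open>The Lie algebras \<open>lie_B\<close> and the spaces \<open>M_space\<close>\<close>

abbreviation xg :: "nat \<Rightarrow> nat \<Rightarrow> (nat \<times> nat) lie_term" where
  "xg i j \<equiv> Gen (i, j)"

definition lie_B_relations :: "nat \<Rightarrow> ((nat \<times> nat) lie_term \<times> (nat \<times> nat) lie_term) set" where
  "lie_B_relations n =
     {(xg i j, xg j i) | i j. i \<in> {1..n} \<and> j \<in> {1..n}} \<union>
     {(xg i i, Zero) | i. i \<in> {1..n}} \<union>
     {(Bracket (xg i j) (xg l m), Zero) | i j l m.
        i \<in> {1..n} \<and> j \<in> {1..n} \<and> l \<in> {1..n} \<and> m \<in> {1..n} \<and> {i, j} \<inter> {l, m} = {}} \<union>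
     {(Bracket (xg i j) (xg j l), Bracket (xg j l) (xg l i)) | i j l.
        i \<in> {1..n} \<and> j \<in> {1..n} \<and> l \<in> {1..n}} \<union>
     {(Bracket (xg j l) (xg l i), Bracket (xg l i) (xg i j)) | i j l.
        i \<in> {1..n} \<and> j \<in> {1..n} \<and> l \<in> {1..n}}"

definition lie_B :: "nat \<Rightarrow> (rat, (nat \<times> nat) lie_term set) module" where
  "lie_B n = presented_lie ({1..n} \<times> {1..n}) (lie_B_relations n)"

definition x_class :: "nat \<Rightarrow> nat \<Rightarrow> nat \<Rightarrow> (nat \<times> nat) lie_term set" where
  "x_class n i j = lie_class ({1..n} \<times> {1..n}) (lie_B_relations n) (xg i j)"

text \<open>\<open>bracket_of L y I v m\<close>: the element \<open>v\<close> of \<open>L\<close> is an iterated bracket, with any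
  bracketing, of the elements \<open>y i\<close> for \<open>i \<in> I\<close>, and \<open>m\<close> is the multiset of the indices used.
  The degree of this bracket is \<open>size m\<close>.\<close>

inductive bracket_of ::
    "('k, 'b, 'z) module_scheme \<Rightarrow> (nat \<Rightarrow> 'b) \<Rightarrow> nat set \<Rightarrow> 'b \<Rightarrow> nat multiset \<Rightarrow> bool"
  for L :: "('k, 'b, 'z) module_scheme" and y :: "nat \<Rightarrow> 'b" and I :: "nat set" where
  single: "i \<in> I \<Longrightarrow> bracket_of L y I (y i) {#i#}"
| bracket: "\<lbrakk>bracket_of L y I v m; bracket_of L y I w m'\<rbrakk> \<Longrightarrow>
    bracket_of L y I (v \<otimes>\<^bsub>L\<^esub> w) (m + m')"

definition M_brackets :: "nat \<Rightarrow> nat \<Rightarrow> (nat \<times> nat) lie_term set set" where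
  "M_brackets d n =
     {v. \<exists>m. bracket_of (lie_B n) (\<lambda>i. x_class n i n) {1..<n} v m \<and> size m = d \<and> set_mset m = {1..<n}}"

text \<open>For \<open>n = 1\<close> there are no brackets, so that \<open>M_space d 1\<close> is the zero space, as it should be
  for \<open>d > 1\<close>.\<close>

definition M_space :: "nat \<Rightarrow> nat \<Rightarrow> (nat \<times> nat) lie_term set set" where
  "M_space d n = LinearCombinations.module.span class_ring (lie_B n) (M_brackets d n)"

definition M_dim :: "nat \<Rightarrow> nat \<Rightarrow> nat" where
  "M_dim d n = vectorspace.dim class_ring ((lie_B n)\<lparr>carrier := M_space d n\<rparr>)"

text \<open>The set of summation is finite, see \<open>finite_M_support\<close>, and the dimensions
  are those of finite-dimensional spaces, see \<open>fin_dim_M_space\<close>.\<close>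

definition M_euler_char :: "nat \<Rightarrow> int" where
  "M_euler_char d = (\<Sum>n | n \<ge> 1 \<and> M_space d n \<noteq> {\<zero>\<^bsub>lie_B n\<^esub>}. (-1) ^ n * int (M_dim d n))"

lemma lie_algebra_lie_B: "lie_algebra class_ring (lie_B n)"
  unfolding lie_B_def by (rule lie_algebra_presented_lie)

lemma bracket_of_finite:
  assumes "finite I"
  shows "finite {v. \<exists>m. bracket_of L y I v m \<and> size m = d}"
proof (induction d rule: less_induct)
  case (less d)
  let ?S = "\<lambda>d. {v. \<exists>m. bracket_of L y I v m \<and> size m = d}"
  have pos: "bracket_of L y I v m \<Longrightarrow> size m > 0" for v m
    by (induction rule: bracket_of.induct) auto
  have "?S d \<subseteq> y ` I \<union> (\<Union>e<d. \<Union>f<d. (\<lambda>(v, w). v \<otimes>\<^bsub>L\<^esub> w) ` (?S e \<times> ?S f))"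
  proof
    fix v assume "v \<in> ?S d"
    then obtain m where m: "bracket_of L y I v m" "size m = d" by auto
    from m(1) show "v \<in> y ` I \<union> (\<Union>e<d. \<Union>f<d. (\<lambda>(v, w). v \<otimes>\<^bsub>L\<^esub> w) ` (?S e \<times> ?S f))"
    proof cases
      case (bracket v1 m1 v2 m2)
      have "size m1 < d" "size m2 < d"
        using pos[OF bracket(3)] pos[OF bracket(4)] bracket(2) m(2) by auto
      moreover have "(v1, v2) \<in> ?S (size m1) \<times> ?S (size m2)" using bracket by auto
      ultimately show ?thesis using bracket(1) by blast
    qed auto
  qed
  moreover have "finite (y ` I \<union> (\<Union>e<d. \<Union>f<d. (\<lambda>(v, w). v \<otimes>\<^bsub>L\<^esub> w) ` (?S e \<times> ?S f)))"
    using assms less by auto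
  ultimately show ?case by (rule finite_subset)
qed

lemma finite_M_brackets: "finite (M_brackets d n)"
  by (rule finite_subset[OF _ bracket_of_finite[of "{1..<n}" "lie_B n" "\<lambda>i. x_class n i n" d]])
     (auto simp: M_brackets_def)

lemma M_brackets_carrier: "M_brackets d n \<subseteq> carrier (lie_B n)"
proof -
  interpret lie_algebra class_ring "lie_B n" by (rule lie_algebra_lie_B)
  have "v \<in> carrier (lie_B n)" if "bracket_of (lie_B n) (\<lambda>i. x_class n i n) {1..<n} v m" for v m
    using that
  proof (induction rule: bracket_of.induct)
    case (single i)
    then show ?case by (auto simp: x_class_def lie_B_def carrier_presented_lie)
  next
    case (bracket v m w m')
    then show ?case by (blast intro: bracket_closed)
  qed
  then show ?thesis by (auto simp: M_brackets_def)
qed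

lemma M_eq_zero:
  assumes "n > d + 1"
  shows "M_space d n = {\<zero>\<^bsub>lie_B n\<^esub>}"
proof -
  interpret lie_algebra class_ring "lie_B n" by (rule lie_algebra_lie_B)
  have le: "n \<le> d + 1" if "set_mset m = {1..<n}" "size m = d" for m :: "nat multiset"
  proof -
    have "card (set_mset m) \<le> size m"
      using size_mset_mono[OF mset_set_set_mset_msubset[of m]] by simp
    then show ?thesis using that by simp
  qed
  have "\<not> (set_mset m = {1..<n} \<and> size m = d)" for m :: "nat multiset"
    using assms le[of m] by linarith
  then have "M_brackets d n = {}" unfolding M_brackets_def by blast
  then show ?thesis by (simp add: M_space_def span_empty)
qed

lemma finite_M_support: "finite {n. n \<ge> 1 \<and> M_space d n \<noteq> {\<zero>\<^bsub>lie_B n\<^esub>}}"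
  by (rule finite_subset[of _ "{..d + 1}"]) (use M_eq_zero in force)+

lemma subspace_M_space: "VectorSpace.subspace class_ring (M_space d n) (lie_B n)"
proof -
  interpret lie_algebra class_ring "lie_B n" by (rule lie_algebra_lie_B)
  show ?thesis unfolding M_space_def by (rule span_is_subspace[OF M_brackets_carrier])
qed

lemma fin_dim_M_space: "vectorspace.fin_dim class_ring ((lie_B n)\<lparr>carrier := M_space d n\<rparr>)"
proof -
  interpret lie_algebra class_ring "lie_B n" by (rule lie_algebra_lie_B)
  interpret W: vectorspace class_ring "(lie_B n)\<lparr>carrier := M_space d n\<rparr>"
    by (rule subspace_is_vs[OF subspace_M_space])
  have sub: "M_brackets d n \<subseteq> M_space d n"
    unfolding M_space_def by (rule in_own_span[OF M_brackets_carrier])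
  have "submodule class_ring (M_space d n) (lie_B n)"
    unfolding M_space_def by (rule span_is_submodule[OF M_brackets_carrier])
  from span_li_not_depend(1)[OF sub this]
  have "W.gen_set (M_brackets d n)" by (simp add: M_space_def)
  then show ?thesis unfolding W.fin_dim_def using finite_M_brackets sub by auto
qed

end

theory Submission
  imports Defs "HOL-Combinatorics.Permutations"
begin

text \<open>The space \<open>M_space d n\<close> is spanned by the right-nested brackets \<open>r w\<close> of the words \<open>w\<close> of length
  \<open>d\<close> whose set of letters is \<open>{1..<n}\<close>. Let \<open>\<theta>\<close> expand a nested bracket into a signed sum of words.
  The Dynkin-Specht-Wever identity says that \<open>r\<close>, extended linearly, maps \<open>\<theta> w\<close> to \<open>d \<cdot> r w\<close>.
  On the other hand \<open>lie_B n\<close> acts on noncommutative power series in \<open>n - 1\<close> variables, with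
  \<open>x\<^sub>i\<^sub>n\<close> acting by left multiplication and the other generators by derivations, so that the
  coefficients of \<open>\<theta> w\<close> are well-defined linear functions of \<open>r w\<close>. Hence \<open>d \<cdot> dim (M_space d n)\<close> is the trace of
  \<open>\<theta>\<close>, and no basis of the free Lie algebra is needed.

  Since \<open>\<theta>\<close> is a signed sum of permutations \<open>p\<close> of the positions, the trace counts surjections
  \<open>f\<close> onto \<open>{1..<n}\<close> with \<open>f \<circ> p = f\<close>. The alternating sum over \<open>n\<close> of their numbers is \<open>\<plusminus>sign p\<close>, and
  the signed sum of \<open>sign p\<close> over \<open>\<theta>\<close> is a product of factors \<open>1 + (-1)\<^sup>e\<close> for \<open>e < d - 1\<close>, which vanishes for
  \<open>d > 2\<close>.\<close>

section \<open>Surjections fixed by a permutation\<close>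

definition fixed_surj :: "('a \<Rightarrow> 'a) \<Rightarrow> 'a set \<Rightarrow> 'b set \<Rightarrow> ('a \<Rightarrow> 'b) set" where
  "fixed_surj p S J = {f \<in> S \<rightarrow>\<^sub>E J. f ` S = J \<and> (\<forall>i\<in>S. f (p i) = f i)}"

lemma finite_fixed_surj: "finite S \<Longrightarrow> finite J \<Longrightarrow> finite (fixed_surj p S J)"
  by (rule finite_subset[of _ "S \<rightarrow>\<^sub>E J"]) (auto simp: fixed_surj_def intro: finite_PiE)

text \<open>At a fixed point \<open>a\<close> the value \<open>y\<close> is unconstrained; the
  values on \<open>S\<close> then exhaust \<open>J\<close> or miss exactly \<open>y\<close>.\<close>

lemma card_fixed_surj_fixpoint:
  fixes J :: "'b set"
  assumes "finite S" "a \<notin> S" "p permutes insert a S" "p a = a" "finite J"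
  shows "card (fixed_surj p (insert a S) J) =
    (\<Sum>y\<in>J. card (fixed_surj p S J) + card (fixed_surj p S (J - {y})))"
proof -
  have pS: "p permutes S"
    using permutes_insert_lemma[OF assms(3)] assms(4) by simp
  define B where "B y = fixed_surj p S J \<union> fixed_surj p S (J - {y})" for y
  have "fixed_surj p (insert a S) J = (\<lambda>(y, g). g(a := y)) ` (SIGMA y:J. B y)"
  proof (intro equalityI subsetI)
    fix f assume f: "f \<in> fixed_surj p (insert a S) J"
    let ?g = "restrict f S"
    have e: "f = ?g(a := f a)" using f assms(2) by (auto simp: fixed_surj_def fun_eq_iff PiE_def extensional_def)
    have "f a \<in> J" using f by (auto simp: fixed_surj_def)
    have i: "\<forall>i\<in>S. ?g (p i) = ?g i" using f permutes_in_image[OF pS] by (auto simp: fixed_surj_def)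
    have "f ` S = J \<or> f ` S = J - {f a}"
      using f by (cases "f a \<in> f ` S") (auto simp: fixed_surj_def, metis imageI)
    then have "?g \<in> B (f a)" using i by (auto simp: B_def fixed_surj_def)
    then show "f \<in> (\<lambda>(y, g). g(a := y)) ` (SIGMA y:J. B y)" 
      using e \<open>f a \<in> J\<close> by (intro image_eqI[of _ _ "(f a, ?g)"]) auto
  next
    fix f assume "f \<in> (\<lambda>(y, g). g(a := y)) ` (SIGMA y:J. B y)"
    then obtain y g where g: "y \<in> J" "g \<in> B y" "f = g(a := y)" by auto
    have ne: "i \<noteq> a \<and> p i \<noteq> a" if "i \<in> S" for i using that assms(2) permutes_in_image[OF pS] by metis
    have "f ` S = g ` S" using g ne by auto
    then have "f ` insert a S = J" using g by (auto simp: B_def fixed_surj_def)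
    moreover have "\<forall>i\<in>insert a S. f (p i) = f i" using g ne assms(4) by (auto simp: B_def fixed_surj_def)
    moreover have "f \<in> extensional (insert a S)" using g by (auto simp: B_def fixed_surj_def PiE_def extensional_def)
    ultimately show "f \<in> fixed_surj p (insert a S) J" by (auto simp: fixed_surj_def PiE_def)
  qed
  moreover have "inj_on (\<lambda>(y, g). g(a := y)) (SIGMA y:J. B y)"
  proof (rule inj_onI, clarsimp)
    fix y g y' g' assume *: "g \<in> B y" "g' \<in> B y'" "g(a := y) = g'(a := y')"
    then have "y = y'" by (metis fun_upd_same)
    \<comment> \<open>Members of \<open>B y\<close> are \<open>undefined\<close> off
      \<open>S\<close>, so \<open>g\<close> is recovered from \<open>g(a := y)\<close> by resetting
      the value at \<open>a\<close>.\<close>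
    moreover have "g a = undefined" "g' a = undefined"
      using * assms(2) by (auto simp: B_def fixed_surj_def PiE_def extensional_def)
    then have "g = g'" using *(3) by (metis fun_upd_triv fun_upd_upd)
    ultimately show "y = y' \<and> g = g'" by simp
  qed
  moreover have fB: "finite (B y)" for y
    unfolding B_def using assms(1,5) by (simp add: finite_fixed_surj)
  \<comment> \<open>The two families are disjoint because their members have different
    images.\<close>
  moreover have "card (B y) = card (fixed_surj p S J) + card (fixed_surj p S (J - {y}))" if "y \<in> J" for y
    unfolding B_def using assms(1,5) that
    by (intro card_Un_disjoint finite_fixed_surj) (auto simp: fixed_surj_def)
  ultimately show ?thesis using assms(5) by (simp add: card_image)
qed

text \<open>The value at \<open>a\<close> is forced to be the one at \<open>p a\<close>. So
  \<open>a\<close> can be cut out of its cycle, and \<open>transpose a (p a) \<circ> p\<close> is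
  the shortened permutation.\<close>

lemma card_fixed_surj_transpose:
  assumes "a \<notin> S" "p permutes insert a S" "p a \<noteq> a"
  shows "card (fixed_surj p (insert a S) J) = card (fixed_surj (transpose a (p a) \<circ> p) S J)"
proof (rule bij_betw_same_card)
  let ?q = "transpose a (p a) \<circ> p"
  have q: "?q permutes S" by (rule permutes_insert_lemma[OF assms(2)])
  have paS: "p a \<in> S" using assms permutes_in_image[OF assms(2), of a] by auto
  have inj: "inj p" using assms(2) by (rule permutes_inj)
  \<comment> \<open>\<open>?q\<close> differs from \<open>p\<close> only at the preimage of
    \<open>a\<close>, which now goes straight to \<open>p a\<close>; injectivity excludes
    \<open>p i = p a\<close>.\<close>
  have qi: "?q i = (if p i = a then p a else p i)" if "i \<in> S" for i
    using that assms(1) inj by (auto simp: transpose_def inj_eq)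
  show "bij_betw (\<lambda>f. restrict f S) (fixed_surj p (insert a S) J) (fixed_surj ?q S J)"
  proof (rule bij_betw_byWitness[where f' = "\<lambda>g. g(a := g (p a))"])
    show "\<forall>f\<in>fixed_surj p (insert a S) J. (restrict f S)(a := restrict f S (p a)) = f"
      using paS assms(1) by (auto simp: fixed_surj_def fun_eq_iff PiE_def extensional_def)
    show "\<forall>g\<in>fixed_surj ?q S J. restrict (g(a := g (p a))) S = g"
      using assms(1) by (auto simp: fixed_surj_def fun_eq_iff PiE_def extensional_def)
    show "(\<lambda>f. restrict f S) ` fixed_surj p (insert a S) J \<subseteq> fixed_surj ?q S J"
    proof (clarify)
      fix f assume f: "f \<in> fixed_surj p (insert a S) J"
      have fpa: "f (p a) = f a" using f by (auto simp: fixed_surj_def)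
      have "f (?q i) = f i" if "i \<in> S" for i
        unfolding qi[OF that] using f that fpa by (auto simp: fixed_surj_def)
      then have "\<forall>i\<in>S. restrict f S (?q i) = restrict f S i"
        using permutes_in_image[OF q] by simp
      moreover have "f ` S = J" using f fpa paS by (auto simp: fixed_surj_def image_iff) metis
      moreover have "restrict f S \<in> S \<rightarrow>\<^sub>E J" using f by (auto simp: fixed_surj_def)
      ultimately show "restrict f S \<in> fixed_surj ?q S J" by (auto simp: fixed_surj_def)
    qed
    show "(\<lambda>g. g(a := g (p a))) ` fixed_surj ?q S J \<subseteq> fixed_surj p (insert a S) J"
    proof clarify
      fix g assume g: "g \<in> fixed_surj ?q S J"
      let ?f = "g(a := g (p a))"
      have gq: "g (?q i) = g i" if "i \<in> S" for i using g that by (auto simp: fixed_surj_def)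
      have "?f (p i) = ?f i" if "i \<in> insert a S" for i
      proof (cases "i = a")
        case False
        then have "i \<in> S" using that by auto
        then show ?thesis using gq[of i] qi[of i] False by (auto split: if_splits)
      qed (use assms in auto)
      moreover have "?f ` insert a S = J" using g paS assms(1) by (auto simp: fixed_surj_def)
      moreover have "?f \<in> extensional (insert a S)" using g by (auto simp: fixed_surj_def PiE_def extensional_def)
      ultimately show "?f \<in> fixed_surj p (insert a S) J" by (auto simp: fixed_surj_def PiE_def)
    qed
  qed
qed

text \<open>An invariant function is constant on the cycles of \<open>p\<close>. With c cycles,
  \<open>s j\<close> counts the surjections from c points onto j points; the alternating sum of
  these numbers is (-1)^c, and \<open>sign p\<close> is (-1)^(card S - c). The induction removes one
  point at a time. The function \<open>s\<close> records that the counts depend only on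
  \<open>card J\<close>, which the step needs for the sets \<open>J - {y}\<close>.\<close>

lemma fixed_surj_alternating_sum:
  assumes "finite S" "p permutes S"
  shows "\<exists>s. (\<forall>J::nat set. finite J \<longrightarrow> card (fixed_surj p S J) = s (card J)) \<and>
    (\<forall>j>card S. s j = 0) \<and> (\<Sum>j\<le>card S. (-1) ^ j * int (s j)) = (-1) ^ card S * sign p"
  using assms
proof (induction S arbitrary: p rule: finite_induct)
  case empty
  then have "sign p = 1" by simp
  moreover have "card (fixed_surj p {} J) = (if card J = 0 then 1 else 0)" if "finite J" for J :: "nat set"
    using that by (auto simp: fixed_surj_def)
  ultimately show ?case by (intro exI[of _ "\<lambda>j. if j = 0 then 1 else 0"]) simp
next
  case (insert a S)
  let ?q = "transpose a (p a) \<circ> p"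
  have q: "?q permutes S" by (rule permutes_insert_lemma[OF insert.prems])
  from insert.IH[OF this] obtain s where
    s: "\<And>J::nat set. finite J \<Longrightarrow> card (fixed_surj ?q S J) = s (card J)" "\<And>j. j > card S \<Longrightarrow> s j = 0"
      "(\<Sum>j\<le>card S. (-1) ^ j * int (s j)) = (-1) ^ card S * sign ?q" by blast
  show ?case
  proof (cases "p a = a")
    case True
    then have qp: "?q = p" by simp
    \<comment> \<open>This is the recursion at a fixed point, summed over the \<open>card J\<close>
      choices of \<open>y\<close>. At \<open>j = 0\<close> the truncated \<open>j - 1\<close> is
      harmless because of the factor \<open>j\<close>.\<close>
    define s' where "s' j = j * (s j + s (j - 1))" for j
    have "card (fixed_surj p (insert a S) J) = s' (card J)" if "finite J" for J :: "nat set"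
      using card_fixed_surj_fixpoint[OF insert(1,2) insert.prems True that] s(1) that
      by (simp add: qp s'_def algebra_simps)
    moreover have "\<forall>j>card (insert a S). s' j = 0" using s(2) insert(1,2) by (auto simp: s'_def)
    \<comment> \<open>\<open>s j\<close> enters \<open>s' j\<close> with weight \<open>j\<close> and
      \<open>s' (j + 1)\<close> with weight \<open>j + 1\<close> and opposite sign, so one negative
      copy remains. For \<open>m = card S\<close> the boundary term is 0.\<close>
    moreover have "(\<Sum>j\<le>Suc m. (-1) ^ j * int (s' j)) =
      - (\<Sum>j\<le>m. (-1) ^ j * int (s j)) + (-1) ^ Suc m * int (Suc m * s (Suc m))" for m
      by (induction m) (simp_all add: s'_def algebra_simps)
    then have "(\<Sum>j\<le>card (insert a S). (-1) ^ j * int (s' j)) = (-1) ^ card (insert a S) * sign p"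
      using s(2,3) insert(1,2) by (simp add: qp)
    ultimately show ?thesis by blast
  next
    case False
    \<comment> \<open>Cutting out \<open>a\<close> composes \<open>p\<close> with one transposition.
      The change of sign matches the change in the parity of the cardinality, so the same
      \<open>s\<close> works.\<close>
    have "permutation p" using insert.prems insert(1) permutation_permutes by blast
    then have "sign ?q = - sign p" using False
      by (simp add: sign_compose permutation_swap_id sign_swap_id)
    then have "(\<Sum>j\<le>card (insert a S). (-1) ^ j * int (s j)) = (-1) ^ card (insert a S) * sign p"
      using s(2,3) insert(1,2) by simp
    moreover have "\<forall>j>card (insert a S). s j = 0" using s(2) insert(1,2) by auto
    moreover have "card (fixed_surj p (insert a S) J) = s (card J)" if "finite J" for J :: "nat set"
      using card_fixed_surj_transpose[OF insert(2) insert.prems False, of J] s(1)[OF that] by simp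
    ultimately show ?thesis by blast
  qed
qed

section \<open>The trace of the Dynkin operator\<close>

text \<open>The expansion of a nested bracket in the free associative algebra, by [a, P] = aP - Pa.
  Equal words are not collected, so that each entry corresponds to one permutation of the
  positions.\<close>

fun dynkin :: "'a list \<Rightarrow> (rat \<times> 'a list) list" where
  "dynkin [] = []"
| "dynkin [a] = [(1, [a])]"
| "dynkin (a # b # w) =
    map (\<lambda>(s, v). (s, a # v)) (dynkin (b # w)) @ map (\<lambda>(s, v). (- s, v @ [a])) (dynkin (b # w))"

lemma dynkin_Cons:
  "w \<noteq> [] \<Longrightarrow> dynkin (a # w) =
    map (\<lambda>(s, v). (s, a # v)) (dynkin w) @ map (\<lambda>(s, v). (- s, v @ [a])) (dynkin w)"
  by (cases w) auto

lemma mset_dynkin: "(s, v) \<in> set (dynkin w) \<Longrightarrow> mset v = mset w"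
  by (induction w arbitrary: s v rule: dynkin.induct) auto

definition dynkin_coeff :: "'a list \<Rightarrow> 'a list \<Rightarrow> rat" where
  "dynkin_coeff w v = (\<Sum>(s, u)\<leftarrow>dynkin w. if u = v then s else 0)"

text \<open>Passes from collected coefficients back to the list of terms; \<open>W\<close> only has
  to contain all rearrangements of \<open>w\<close>.\<close>

lemma sum_dynkin_coeff:
  assumes "finite W" "\<And>v. mset v = mset w \<Longrightarrow> v \<in> W"
  shows "(\<Sum>v\<in>W. dynkin_coeff w v * g v) = (\<Sum>(s, v)\<leftarrow>dynkin w. s * g v)"
proof -
  have "(\<Sum>v\<in>W. (\<Sum>(s, u)\<leftarrow>xs. if u = v then s else 0) * g v) = (\<Sum>(s, v)\<leftarrow>xs. s * g v)"
    if "snd ` set xs \<subseteq> W" for xs :: "(rat \<times> 'a list) list"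
    using that
  proof (induction xs)
    case (Cons x xs)
    then show ?case
      using assms(1) by (cases x) (simp add: distrib_right sum.distrib if_distrib[of "\<lambda>z. z * _"] cong: if_cong)
  qed simp
  moreover have "snd ` set (dynkin w) \<subseteq> W" using mset_dynkin assms(2) by fastforce
  ultimately show ?thesis unfolding dynkin_coeff_def by blast
qed

text \<open>The word of a function, read from right to left, so that \<open>dynkin\<close> recurses on the last
  position.\<close>

definition word_of :: "nat \<Rightarrow> (nat \<Rightarrow> 'a) \<Rightarrow> 'a list" where
  "word_of d f = rev (map f [0..<d])"

lemma word_of_Suc: "word_of (Suc d) f = f d # word_of d f"
  by (simp add: word_of_def)

lemma word_of_eq_iff: "word_of d f = word_of d g \<longleftrightarrow> (\<forall>i<d. f i = g i)"
  by (auto simp: word_of_def)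

section \<open>The permutations behind the expansion, and their signs\<close>

primrec back_cycle :: "nat \<Rightarrow> nat \<Rightarrow> nat" where
  "back_cycle 0 = id"
| "back_cycle (Suc d) = transpose d (Suc d) \<circ> back_cycle d"

lemma back_cycle_eq: "back_cycle d i = (if i = 0 then d else if i \<le> d then i - 1 else i)"
  by (induction d arbitrary: i) (auto simp: transpose_def)

lemma back_cycle_permutes: "back_cycle d permutes {..d}"
proof (induction d)
  case (Suc d)
  then have "back_cycle d permutes {..Suc d}" by (rule permutes_subset) auto
  moreover have "transpose d (Suc d) permutes {..Suc d}" by (rule permutes_swap_id) auto
  ultimately show ?case unfolding back_cycle.simps by (rule permutes_compose)
qed (simp add: permutes_id id_def)

lemma sign_back_cycle: "sign (back_cycle d) = (-1) ^ d"
proof (induction d)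
  case (Suc d)
  have "permutation (back_cycle d)"
    using back_cycle_permutes permutation_permutes by blast
  then show ?case
    unfolding back_cycle.simps by (subst sign_compose) (simp_all add: Suc permutation_swap_id sign_swap_id)
qed simp

text \<open>The permutations of the positions by which \<open>dynkin\<close> rearranges a word of length \<open>Suc d\<close>.\<close>

primrec dynkin_perms :: "nat \<Rightarrow> (int \<times> (nat \<Rightarrow> nat)) list" where
  "dynkin_perms 0 = [(1, id)]"
| "dynkin_perms (Suc d) =
    dynkin_perms d @ map (\<lambda>(s, p). (- s, p \<circ> back_cycle (Suc d))) (dynkin_perms d)"

lemma dynkin_perms_permutes: "(s, p) \<in> set (dynkin_perms d) \<Longrightarrow> p permutes {..d}"
proof (induction d arbitrary: s p)
  case (Suc d)
  have "q permutes {..Suc d}" if "(t, q) \<in> set (dynkin_perms d)" for t q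
    by (rule permutes_subset[OF Suc.IH[OF that]]) auto
  then show ?case using Suc.prems permutes_compose[OF back_cycle_permutes[of "Suc d"]] by auto
qed (simp add: permutes_id)

text \<open>The letter of the new last position stays at the front of the reversed word, or it goes
  to the end, that is, to position 0, while the others move up by one. The second case is
  composition with \<open>back_cycle\<close>.\<close>

lemma dynkin_word_of:
  "dynkin (word_of (Suc d) f) = map (\<lambda>(s, p). (of_int s, word_of (Suc d) (f \<circ> p))) (dynkin_perms d)"
proof (induction d)
  case 0
  then show ?case by (simp add: word_of_def)
next
  case (Suc d)
  have 1: "f (Suc d) # word_of (Suc d) (f \<circ> p) = word_of (Suc (Suc d)) (f \<circ> p)"
    if "(s, p) \<in> set (dynkin_perms d)" for s p
    using permutes_not_in[OF dynkin_perms_permutes[OF that], of "Suc d"] by (simp add: word_of_Suc)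
  have 2: "word_of (Suc d) (f \<circ> p) @ [f (Suc d)] = word_of (Suc (Suc d)) (f \<circ> (p \<circ> back_cycle (Suc d)))"
    if "(s, p) \<in> set (dynkin_perms d)" for s p
  proof -
    have p: "p (Suc d) = Suc d"
      using permutes_not_in[OF dynkin_perms_permutes[OF that], of "Suc d"] by simp
    have "map (f \<circ> (p \<circ> back_cycle (Suc d))) [0..<Suc (Suc d)] =
      f (Suc d) # map (f \<circ> p) [0..<Suc d]"
      using p by (simp add: upt_rec[of 0 "Suc (Suc d)"] back_cycle_eq o_def
          flip: map_Suc_upt del: upt_Suc back_cycle.simps)
    then show ?thesis by (simp only: word_of_def rev.simps(2))
  qed
  have ne: "word_of (Suc d) f \<noteq> []" by (simp add: word_of_Suc)
  show ?case
    unfolding word_of_Suc[of "Suc d" f] dynkin_Cons[OF ne] Suc.IH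
    by (auto simp: 1 2 simp del: back_cycle.simps) (simp_all add: o_def del: back_cycle.simps)
qed

text \<open>The minus sign of the second half and the sign \<open>(-1) ^ Suc d\<close> of the cycle
  combine to \<open>(-1) ^ d\<close>.\<close>

lemma sum_sign_dynkin_perms_Suc:
  "(\<Sum>(s, p)\<leftarrow>dynkin_perms (Suc d). s * sign p) =
    (1 + (-1) ^ d) * (\<Sum>(s, p)\<leftarrow>dynkin_perms d. s * sign p)"
proof -
  have "sign (p \<circ> back_cycle (Suc d)) = (-1) ^ Suc d * sign p"
    if "(s, p) \<in> set (dynkin_perms d)" for s p
  proof -
    have "permutation p"
      using dynkin_perms_permutes[OF that] permutation_permutes by blast
    moreover have "permutation (back_cycle (Suc d))"
      using back_cycle_permutes permutation_permutes by blast
    ultimately show ?thesis by (simp only: sign_compose sign_back_cycle mult.commute)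
  qed
  then have "(\<Sum>(s, p)\<leftarrow>dynkin_perms d. - s * sign (p \<circ> back_cycle (Suc d))) =
    (\<Sum>(s, p)\<leftarrow>dynkin_perms d. (-1) ^ d * (s * sign p))"
    by (intro arg_cong[where f = sum_list] map_cong) auto
  also have "\<dots> = (-1) ^ d * (\<Sum>(s, p)\<leftarrow>dynkin_perms d. s * sign p)"
    by (simp add: sum_list_const_mult case_prod_unfold)
  finally show ?thesis
    by (simp add: o_def case_prod_unfold distrib_right)
qed

lemma sum_sign_dynkin_perms: "d \<ge> 2 \<Longrightarrow> (\<Sum>(s, p)\<leftarrow>dynkin_perms d. s * sign p) = 0"
proof (induction d rule: dec_induct)
  case base
  \<comment> \<open>The factor of the step from 1 to 2 vanishes, and every later sum contains
    it.\<close>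
  have "(1 + (-1) ^ Suc 0 :: int) = 0" by simp
  then show ?case unfolding numeral_2_eq_2 sum_sign_dynkin_perms_Suc by simp
qed (simp add: sum_sign_dynkin_perms_Suc del: dynkin_perms.simps)

text \<open>The diagonal coefficient at the word of \<open>f\<close> is the signed number of
  \<open>p\<close> that fix \<open>f\<close>. After exchanging the sums, each \<open>p\<close>
  contributes an alternating count of fixed surjections, which is its sign up to
  \<open>(-1) ^ d\<close>.\<close>

lemma alternating_sum_dynkin_trace:
  assumes "d > 2"
  shows "(\<Sum>k\<le>d. (-1) ^ k * (\<Sum>w | length w = d \<and> set w = {1..k}. dynkin_coeff w w)) = 0"
proof -
  \<comment> \<open>\<open>dynkin_perms e\<close> rearranges words of length \<open>Suc e\<close>;
    the signed sum vanishes from \<open>e = 2\<close> on.\<close>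
  obtain e where e: "d = Suc e" "e \<ge> 2" using assms by (cases d) auto
  let ?F = "\<lambda>k::nat. {f \<in> {..<d} \<rightarrow>\<^sub>E {1..k}. f ` {..<d} = {1..k}}"
  have words: "(\<Sum>w | length w = d \<and> set w = {1..k}. g w) = (\<Sum>f\<in>?F k. g (word_of d f))"
    for g :: "nat list \<Rightarrow> rat" and k :: nat
  proof (rule sum.reindex_bij_witness[where i = "word_of d" and j = "\<lambda>w. restrict (\<lambda>i. rev w ! i) {..<d}"])
    fix w assume "w \<in> {w. length w = d \<and> set w = {1..k}}"
    then have w: "length w = d" "set w = {1..k}" by auto
    have mw: "map (restrict (\<lambda>i. rev w ! i) {..<d}) [0..<d] = rev w"
      using w by (auto intro: nth_equalityI)
    then show ww: "word_of d (restrict (\<lambda>i. rev w ! i) {..<d}) = w" by (simp add: word_of_def)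
    have "(\<lambda>i. rev w ! i) ` {..<d} = set w" 
      using arg_cong[OF mw, of set] by (simp add: lessThan_atLeast0)
    then show "restrict (\<lambda>i. rev w ! i) {..<d} \<in> ?F k" using w by auto
    show "g (word_of d (restrict (\<lambda>i. rev w ! i) {..<d})) = g w" using ww by simp
  next
    fix f assume f: "f \<in> ?F k"
    show "restrict (\<lambda>i. rev (word_of d f) ! i) {..<d} = f"
      using f by (auto simp: word_of_def fun_eq_iff PiE_def extensional_def)
    show "word_of d f \<in> {w. length w = d \<and> set w = {1..k}}"
      using f by (auto simp: word_of_def lessThan_atLeast0)
  qed
  have coeff: "dynkin_coeff (word_of d f) (word_of d f) =
      (\<Sum>(s, p)\<leftarrow>dynkin_perms e. of_int s * (if \<forall>i\<in>{..<d}. f (p i) = f i then 1 else 0))" for f :: "nat \<Rightarrow> nat"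
    unfolding dynkin_coeff_def e(1) dynkin_word_of
    by (auto simp: word_of_eq_iff o_def case_prod_unfold intro!: arg_cong[where f = sum_list])
  have fin: "finite (?F k)" for k :: nat
    by (rule finite_subset[of _ "{..<d} \<rightarrow>\<^sub>E {1..k}"]) (auto intro!: finite_PiE)
  have trace: "(\<Sum>w | length w = d \<and> set w = {1..k}. dynkin_coeff w w) =
     (\<Sum>(s, p)\<leftarrow>dynkin_perms e. of_int s * of_nat (card (fixed_surj p {..<d} {1..k})))" for k :: nat
  proof -
    have "(\<Sum>f\<in>?F k. \<Sum>(s, p)\<leftarrow>xs. of_int s * (if \<forall>i\<in>{..<d}. f (p i) = f i then 1 else 0)) =
      (\<Sum>(s, p)\<leftarrow>xs. of_int s * of_nat (card (fixed_surj p {..<d} {1..k})) :: rat)"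
      for xs :: "(int \<times> (nat \<Rightarrow> nat)) list"
    proof (induction xs)
      case (Cons x xs)
      obtain s p where x: "x = (s, p)" by (cases x)
      have "(\<Sum>f\<in>?F k. if \<forall>i\<in>{..<d}. f (p i) = f i then 1 else 0 :: rat) = of_nat (card (fixed_surj p {..<d} {1..k}))"
        unfolding fixed_surj_def using fin[of k]
        by (simp add: sum.If_cases Int_def conj_assoc)
      then show ?case using Cons by (simp add: x sum.distrib flip: sum_distrib_left)
    qed simp
    then show ?thesis unfolding words coeff .
  qed
  have alt: "(\<Sum>k\<le>d. (-1) ^ k * of_nat (card (fixed_surj p {..<d} {1..k}))) = (of_int ((-1) ^ d * sign p) :: rat)"
    if "(s, p) \<in> set (dynkin_perms e)" for s p
  proof -
    have "p permutes {..<d}"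
      using dynkin_perms_permutes[OF that] by (simp add: e(1) lessThan_Suc_atMost)
    from fixed_surj_alternating_sum[OF _ this] obtain c where
      c: "\<And>J::nat set. finite J \<Longrightarrow> card (fixed_surj p {..<d} J) = c (card J)"
        "(\<Sum>j\<le>d. (-1) ^ j * int (c j)) = (-1) ^ d * sign p" by auto
    have "(\<Sum>k\<le>d. (-1) ^ k * of_nat (card (fixed_surj p {..<d} {1..k}))) =
      (of_int (\<Sum>j\<le>d. (-1) ^ j * int (c j)) :: rat)"
      by (simp add: c(1))
    then show ?thesis unfolding c(2) .
  qed
  have "(\<Sum>k\<le>d. (-1) ^ k * (\<Sum>(s, p)\<leftarrow>xs. of_int s * of_nat (card (fixed_surj p {..<d} {1..k})))) =
    (of_int ((-1) ^ d * (\<Sum>(s, p)\<leftarrow>xs. s * sign p)) :: rat)"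
    if "set xs \<subseteq> set (dynkin_perms e)" for xs
    using that
  proof (induction xs)
    case (Cons x xs)
    obtain s p where x: "x = (s, p)" by (cases x)
    have "(\<Sum>k\<le>d. (-1) ^ k * (of_int s * of_nat (card (fixed_surj p {..<d} {1..k})))) =
        of_int s * (\<Sum>k\<le>d. (-1) ^ k * of_nat (card (fixed_surj p {..<d} {1..k})) :: rat)"
      by (simp add: sum_distrib_left mult.left_commute)
    also have "\<dots> = of_int s * of_int ((-1) ^ d * sign p)"
      using alt[of s p] Cons.prems x by auto
    finally show ?case using Cons by (simp add: x sum.distrib distrib_left algebra_simps)
  qed simp
  from this[of "dynkin_perms e"] show ?thesis
    unfolding trace using sum_sign_dynkin_perms[OF e(2)] by simp
qed

section \<open>Dimension as a trace\<close>

definition functional :: "('k::field, 'v, 'm) module_scheme \<Rightarrow> ('v \<Rightarrow> 'k) \<Rightarrow> bool" where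
  "functional V \<phi> \<longleftrightarrow>
     (\<forall>x\<in>carrier V. \<forall>y\<in>carrier V. \<phi> (x \<oplus>\<^bsub>V\<^esub> y) = \<phi> x + \<phi> y) \<and>
     (\<forall>c. \<forall>x\<in>carrier V. \<phi> (c \<odot>\<^bsub>V\<^esub> x) = c * \<phi> x)"

locale field_vectorspace = vectorspace "class_ring :: 'k::field ring" V for V (structure)
begin

lemma functional_zero: "functional V \<phi> \<Longrightarrow> \<phi> \<zero> = 0"
  unfolding functional_def using smult_l_null[of \<zero>] by (metis mult_zero_left ring.simps(1) zero_closed)

lemma functional_lincomb:
  assumes "functional V \<phi>" "finite A" "A \<subseteq> carrier V"
  shows "\<phi> (lincomb a A) = (\<Sum>v\<in>A. a v * \<phi> v)"
  using assms(2,3)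
proof (induction A rule: finite_induct)
  case empty
  then show ?case using functional_zero[OF assms(1)] by simp
next
  case (insert v A)
  have "lincomb a (insert v A) = a v \<odot> v \<oplus> lincomb a A"
    using insert unfolding lincomb_def by (subst finsum_insert) auto
  moreover have "lincomb a A \<in> carrier V" "a v \<odot> v \<in> carrier V"
    using insert by auto
  ultimately show ?case using insert assms(1) by (simp add: functional_def)
qed

lemma functional_eq_on_span:
  assumes "functional V \<phi>" "functional V \<psi>" "S \<subseteq> carrier V" "\<And>x. x \<in> S \<Longrightarrow> \<phi> x = \<psi> x" "x \<in> span S"
  shows "\<phi> x = \<psi> x"
proof -
  obtain a A where "finite A" "A \<subseteq> S" "x = lincomb a A" using assms(5) unfolding span_def by auto
  then show ?thesis using assms by (simp add: functional_lincomb subset_eq)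
qed

text \<open>By \<open>key\<close>, the endomorphism \<open>x \<mapsto> \<Sum>v\<in>W. \<phi> v x \<cdot> r v\<close> of \<open>V\<close> is \<open>c\<close> times the identity. The right-hand
  side is the trace of the same composite in the other order, on the free space over \<open>W\<close>.\<close>

lemma dim_eq_trace:
  assumes fin: "fin_dim" "finite W" and r: "r ` W \<subseteq> carrier V" "span (r ` W) = carrier V"
    and \<phi>: "\<And>w. w \<in> W \<Longrightarrow> functional V (\<phi> w)"
    and key: "\<And>\<psi> w. functional V \<psi> \<Longrightarrow> w \<in> W \<Longrightarrow> (\<Sum>v\<in>W. \<phi> v (r w) * \<psi> (r v)) = c * \<psi> (r w)"
  shows "c * of_nat dim = (\<Sum>w\<in>W. \<phi> w (r w))"
proof -
  obtain B where B: "finite B" "basis B" using finite_basis_exists[OF fin(1)] by blast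
  then have BV: "B \<subseteq> carrier V" unfolding basis_def by blast
  have ex1: "\<exists>!a. a \<in> B \<rightarrow>\<^sub>E UNIV \<and> lincomb a B = v" if "v \<in> carrier V" for v
    using basis_criterion[OF B(1) BV] B(2) that by auto
  \<comment> \<open>\<open>co v\<close> is the coordinate vector of \<open>v\<close> in the basis
    \<open>B\<close>. It is unique among functions that are \<open>undefined\<close> off
    \<open>B\<close>, whence the restriction in \<open>co_eq\<close>.\<close>
  define co where "co v = (THE a. a \<in> B \<rightarrow>\<^sub>E UNIV \<and> lincomb a B = v)" for v
  have co: "co v \<in> B \<rightarrow>\<^sub>E UNIV" "lincomb (co v) B = v" if "v \<in> carrier V" for v
    using theI'[OF ex1[OF that]] by (auto simp: co_def)
  have co_eq: "co v b = a b" if "lincomb a B = v" "b \<in> B" for a v b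
  proof -
    have "lincomb (restrict a B) B = v"
      using that(1) BV B(1) by (subst lincomb_cong[OF HOL.refl, of B _ a]) auto
    moreover have "v \<in> carrier V" using that(1) BV B(1) by auto
    ultimately have "co v = restrict a B" using ex1[of v] co[of v] by (metis restrict_PiE_iff iso_tuple_UNIV_I)
    then show ?thesis using that(2) by simp
  qed
  have fco: "functional V (\<lambda>v. co v b)" if "b \<in> B" for b
    unfolding functional_def
  proof (intro conjI ballI allI)
    fix x y assume xy: "x \<in> carrier V" "y \<in> carrier V"
    have "lincomb (\<lambda>v. co x v + co y v) B = x \<oplus> y"
      using lincomb_sum[OF B(1) BV, of "co x" "co y"] co xy by simp
    from co_eq[OF this that] show "co (x \<oplus> y) b = co x b + co y b" .
  next
    fix k x assume x: "x \<in> carrier V"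
    have "lincomb (\<lambda>v. k * co x v) B = k \<odot> x"
      using lincomb_smult[OF BV, of "co x" k] co x by simp
    from co_eq[OF this that] show "co (k \<odot> x) b = k * co x b" .
  qed
  have self: "co b b = 1" if "b \<in> B" for b
  proof -
    have "lincomb (\<lambda>v. if v = b then 1 else 0) B = b"
    proof -
      have "b \<in> carrier V" using that BV by auto
      have "lincomb (\<lambda>v. if v = b then 1 else 0) B = (\<lambda>v. if v = b then 1 else 0) b \<odot> b \<oplus> lincomb (\<lambda>v. if v = b then 1 else 0) (B - {b})"
        using that B(1) BV by (intro lincomb_del2) auto
      also have "lincomb (\<lambda>v. if v = b then 1 else 0) (B - {b}) = \<zero>"
        unfolding lincomb_def using BV by (intro add.finprod_one_eqI) (auto simp: smult_l_null[simplified])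
      finally show ?thesis using \<open>b \<in> carrier V\<close> smult_one[of b] by simp
    qed
    from co_eq[OF this that] show ?thesis by simp
  qed
  \<comment> \<open>Both sides are functionals in \<open>x\<close>, so \<open>key\<close> extends
    from the spanning set to all of \<open>V\<close>.\<close>
  have tr: "(\<Sum>v\<in>W. \<phi> v x * \<psi> (r v)) = c * \<psi> x" if "functional V \<psi>" "x \<in> carrier V" for \<psi> x
  proof (rule functional_eq_on_span[where S = "r ` W"])
    show "functional V (\<lambda>x. \<Sum>v\<in>W. \<phi> v x * \<psi> (r v))"
      using \<phi> by (auto simp: functional_def distrib_right sum.distrib sum_distrib_left mult.assoc intro!: sum.cong)
    show "functional V (\<lambda>x. c * \<psi> x)"
      using that(1) by (auto simp: functional_def algebra_simps)
  qed (use that r key in auto)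
  \<comment> \<open>With \<open>\<psi>\<close> the coordinate at \<open>b\<close> and
    \<open>x = b\<close>, this is a diagonal entry of \<open>c\<close> times the identity.\<close>
  have "(\<Sum>v\<in>W. \<phi> v b * co (r v) b) = c" if "b \<in> B" for b
    using tr[OF fco[OF that], of b] self[OF that] that BV by auto
  then have "c * of_nat (card B) = (\<Sum>b\<in>B. \<Sum>v\<in>W. \<phi> v b * co (r v) b)" by simp
  also have "\<dots> = (\<Sum>v\<in>W. \<Sum>b\<in>B. co (r v) b * \<phi> v b)"
    by (subst sum.swap) (simp add: mult.commute)
  also have "\<dots> = (\<Sum>v\<in>W. \<phi> v (r v))"
  proof (rule sum.cong[OF HOL.refl])
    fix v assume "v \<in> W"
    then have "r v = lincomb (co (r v)) B" using co r by auto
    then show "(\<Sum>b\<in>B. co (r v) b * \<phi> v b) = \<phi> v (r v)"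
      using functional_lincomb[OF \<phi>[OF \<open>v \<in> W\<close>] B(1) BV] by metis
  qed
  finally show ?thesis using dim_basis[OF B] by simp
qed

end

section \<open>Linear combinations given by lists of terms\<close>

definition sum_terms :: "('k, 'b, 'z) module_scheme \<Rightarrow> ('w \<Rightarrow> 'b) \<Rightarrow> ('k \<times> 'w) list \<Rightarrow> 'b" where
  "sum_terms L g xs = foldr (\<lambda>(s, v) z. s \<odot>\<^bsub>L\<^esub> g v \<oplus>\<^bsub>L\<^esub> z) xs \<zero>\<^bsub>L\<^esub>"

lemma sum_terms_simps [simp]:
  "sum_terms L g [] = \<zero>\<^bsub>L\<^esub>"
  "sum_terms L g ((s, v) # xs) = s \<odot>\<^bsub>L\<^esub> g v \<oplus>\<^bsub>L\<^esub> sum_terms L g xs"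
  by (simp_all add: sum_terms_def)

text \<open>Lets such sums pass between the Lie algebra and a subspace with the same
  operations.\<close>

lemma sum_terms_carrier_update: "sum_terms (L\<lparr>carrier := M\<rparr>) = sum_terms L"
  by (simp add: sum_terms_def fun_eq_iff)

lemma sum_terms_map: "sum_terms L g (map (\<lambda>(s, v). (s, h v)) xs) = sum_terms L (\<lambda>v. g (h v)) xs"
  by (induction xs) auto

lemma sum_terms_cong: "\<forall>p\<in>set xs. g (snd p) = g' (snd p) \<Longrightarrow> sum_terms L g xs = sum_terms L g' xs"
  by (induction xs) auto

context field_vectorspace
begin

lemma sum_terms_closed:
  "\<forall>p\<in>set xs. g (snd p) \<in> carrier V \<Longrightarrow> sum_terms V g xs \<in> carrier V"
proof (induction xs)
  case (Cons x xs)
  obtain s v where "x = (s, v)" by (cases x)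
  then show ?case using Cons by simp
qed simp

lemma sum_terms_append:
  assumes "\<forall>p\<in>set (xs @ ys). g (snd p) \<in> carrier V"
  shows "sum_terms V g (xs @ ys) = sum_terms V g xs \<oplus> sum_terms V g ys"
  using assms
proof (induction xs)
  case Nil
  then show ?case using sum_terms_closed[of ys g] by simp
next
  case (Cons x xs)
  obtain s v where x: "x = (s, v)" by (cases x)
  have "sum_terms V g xs \<in> carrier V" "sum_terms V g ys \<in> carrier V" "g v \<in> carrier V"
    using Cons.prems x by (auto intro!: sum_terms_closed)
  then show ?case using Cons by (simp add: x a_assoc)
qed

lemma sum_terms_uminus:
  assumes "\<forall>p\<in>set xs. g (h (snd p)) \<in> carrier V"
  shows "sum_terms V g (map (\<lambda>(s, v). (- s, h v)) xs) = \<ominus> sum_terms V (\<lambda>v. g (h v)) xs"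
  using assms
proof (induction xs)
  case Nil
  show ?case by simp (metis M.add.inv_eq_1_iff M.zero_closed)
next
  case (Cons x xs)
  obtain s v where x: "x = (s, v)" by (cases x)
  have "sum_terms V (\<lambda>v. g (h v)) xs \<in> carrier V" "g (h v) \<in> carrier V"
    using Cons.prems x by (auto intro!: sum_terms_closed)
  moreover from this have "(- s) \<odot> g (h v) = \<ominus> (s \<odot> g (h v))"
    using smult_l_minus[of s "g (h v)"] by (simp add: class_ring_simps)
  ultimately show ?case using Cons by (simp add: x minus_add)
qed

lemma functional_sum_terms:
  assumes "functional V \<phi>" "\<forall>p\<in>set xs. g (snd p) \<in> carrier V"
  shows "\<phi> (sum_terms V g xs) = (\<Sum>(s, v)\<leftarrow>xs. s * \<phi> (g v))"
  using assms(2)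
proof (induction xs)
  case Nil
  then show ?case using functional_zero[OF assms(1)] by simp
next
  case (Cons x xs)
  obtain s v where x: "x = (s, v)" by (cases x)
  have "sum_terms V g xs \<in> carrier V" "s \<odot> g v \<in> carrier V" "g v \<in> carrier V"
    using Cons.prems x by (auto intro!: sum_terms_closed)
  then show ?case using Cons assms(1) by (simp add: x functional_def)
qed

end

section \<open>Nested brackets in a Lie algebra\<close>

fun nested :: "('k, 'b, 'z) module_scheme \<Rightarrow> ('i \<Rightarrow> 'b) \<Rightarrow> 'i list \<Rightarrow> 'b" where
  "nested L y [] = \<zero>\<^bsub>L\<^esub>"
| "nested L y [i] = y i"
| "nested L y (i # j # w) = y i \<otimes>\<^bsub>L\<^esub> nested L y (j # w)"

lemma nested_Cons: "w \<noteq> [] \<Longrightarrow> nested L y (i # w) = y i \<otimes>\<^bsub>L\<^esub> nested L y w"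
  by (cases w) auto

definition ad_word :: "('k, 'b, 'z) module_scheme \<Rightarrow> ('i \<Rightarrow> 'b) \<Rightarrow> 'i list \<Rightarrow> 'b \<Rightarrow> 'b" where
  "ad_word L y w z = foldr (\<lambda>i z. y i \<otimes>\<^bsub>L\<^esub> z) w z"

lemma ad_word_simps [simp]:
  "ad_word L y [] z = z"
  "ad_word L y (i # w) z = y i \<otimes>\<^bsub>L\<^esub> ad_word L y w z"
  "ad_word L y (w @ [i]) z = ad_word L y w (y i \<otimes>\<^bsub>L\<^esub> z)"
  by (simp_all add: ad_word_def)

lemma nested_append: "u \<noteq> [] \<Longrightarrow> nested L y (w @ u) = ad_word L y w (nested L y u)"
  by (induction w) (auto simp: nested_Cons)

lemma dynkin_not_Nil: "(s, v) \<in> set (dynkin w) \<Longrightarrow> v \<noteq> []"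
  by (induction w arbitrary: s v rule: dynkin.induct) auto

locale rat_lie_algebra = lie_algebra "class_ring :: rat ring" L
  for L :: "(rat, 'b, 'z) module_scheme" (structure) +
  fixes y :: "nat \<Rightarrow> 'b" and I :: "nat set"
  assumes gen_closed: "i \<in> I \<Longrightarrow> y i \<in> carrier L"
begin

sublocale field_vectorspace L
  by unfold_locales

lemma bracket_zero_right: "x \<in> carrier L \<Longrightarrow> x \<otimes> \<zero> = \<zero>"
  using bracket_smult_right[of 0 x \<zero>] smult_l_null[of \<zero>] smult_l_null[of "x \<otimes> \<zero>"] bracket_closed[of x \<zero>]
  by simp

lemma bracket_uminus_right:
  assumes "x \<in> carrier L" "z \<in> carrier L"
  shows "x \<otimes> (\<ominus> z) = \<ominus> (x \<otimes> z)"
proof -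
  have "x \<otimes> (\<ominus> z) \<oplus> x \<otimes> z = x \<otimes> (\<ominus> z \<oplus> z)"
    using assms by (simp add: bracket_add_right)
  also have "\<dots> = \<zero>" using assms by (simp add: M.l_neg bracket_zero_right)
  finally show ?thesis using assms by (intro M.minus_equality[symmetric]) (auto simp: bracket_closed)
qed

lemma bracket_antisym:
  assumes "x \<in> carrier L" "z \<in> carrier L"
  shows "x \<otimes> z = \<ominus> (z \<otimes> x)"
proof -
  note c = assms bracket_closed
  have "(x \<oplus> z) \<otimes> (x \<oplus> z) = (x \<otimes> x \<oplus> z \<otimes> x) \<oplus> (x \<otimes> z \<oplus> z \<otimes> z)"
    using c by (simp add: bracket_add_left bracket_add_right)
  then have "z \<otimes> x \<oplus> x \<otimes> z = \<zero>" using c by (simp add: bracket_self)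
  then have "x \<otimes> z \<oplus> z \<otimes> x = \<zero>" using c by (simp add: M.a_comm)
  then show ?thesis using c by (intro M.minus_equality[symmetric]) auto
qed

text \<open>The Jacobi identity in the form ad [x, r] = ad x ad r - ad r ad x.\<close>

lemma bracket_bracket_left:
  assumes c: "x \<in> carrier L" "r \<in> carrier L" "z \<in> carrier L"
  shows "(x \<otimes> r) \<otimes> z = x \<otimes> (r \<otimes> z) \<oplus> \<ominus> (r \<otimes> (x \<otimes> z))"
proof -
  note cl = c bracket_closed
  have "r \<otimes> (z \<otimes> x) = \<ominus> (r \<otimes> (x \<otimes> z))"
    using cl bracket_antisym[of z x] by (simp add: bracket_uminus_right)
  moreover have "z \<otimes> (x \<otimes> r) = \<ominus> ((x \<otimes> r) \<otimes> z)" using cl by (intro bracket_antisym) auto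
  ultimately have "(x \<otimes> (r \<otimes> z) \<oplus> \<ominus> (r \<otimes> (x \<otimes> z))) \<oplus> \<ominus> ((x \<otimes> r) \<otimes> z) = \<zero>"
    using jacobi[OF c] cl by (simp add: a_assoc)
  then have "x \<otimes> (r \<otimes> z) \<oplus> \<ominus> (r \<otimes> (x \<otimes> z)) = \<ominus> (\<ominus> ((x \<otimes> r) \<otimes> z))"
    using cl by (intro M.minus_equality[symmetric]) auto
  then show ?thesis using cl by simp
qed

lemma bracket_sum_terms:
  assumes "x \<in> carrier L" "\<forall>p\<in>set xs. g (snd p) \<in> carrier L"
  shows "x \<otimes> sum_terms L g xs = sum_terms L (\<lambda>v. x \<otimes> g v) xs"
  using assms(2)
proof (induction xs)
  case Nil
  then show ?case using assms(1) by (simp add: bracket_zero_right)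
next
  case (Cons p xs)
  obtain s v where p: "p = (s, v)" by (cases p)
  have "sum_terms L g xs \<in> carrier L" "g v \<in> carrier L"
    using Cons.prems p by (auto intro!: sum_terms_closed)
  then show ?case using Cons assms(1) by (simp add: p bracket_add_right bracket_smult_right)
qed

lemma nested_closed: "set w \<subseteq> I \<Longrightarrow> nested L y w \<in> carrier L"
  by (induction w rule: induct_list012) (auto simp: gen_closed bracket_closed)

lemma ad_word_closed: "set w \<subseteq> I \<Longrightarrow> z \<in> carrier L \<Longrightarrow> ad_word L y w z \<in> carrier L"
  by (induction w) (auto simp: gen_closed bracket_closed)

lemma set_dynkin: "(s, v) \<in> set (dynkin w) \<Longrightarrow> set v = set w"
  using mset_dynkin mset_eq_setD by blast

text \<open>Since ad takes brackets to commutators, ad of a nested bracket is its expansion with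
  every letter replaced by its ad.\<close>

lemma nested_bracket:
  assumes "w \<noteq> []" "set w \<subseteq> I" "z \<in> carrier L"
  shows "nested L y w \<otimes> z = sum_terms L (\<lambda>v. ad_word L y v z) (dynkin w)"
  using assms
proof (induction w arbitrary: z rule: induct_list012)
  case (2 i)
  then show ?case using smult_one[of "y i \<otimes> z"] by (simp add: gen_closed bracket_closed)
next
  case (3 i j u)
  define w where "w = j # u"
  have w: "w \<noteq> []" "set w \<subseteq> I" "i \<in> I" and z: "z \<in> carrier L" using 3 by (auto simp: w_def)
  have IH: "nested L y w \<otimes> x = sum_terms L (\<lambda>v. ad_word L y v x) (dynkin w)" if "x \<in> carrier L" for x
    using 3(2)[of x] 3(4) that by (simp add: w_def)
  have yi: "y i \<in> carrier L" using w gen_closed by blast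
  have cl: "\<forall>p\<in>set (dynkin w). ad_word L y (snd p) x \<in> carrier L" if "x \<in> carrier L" for x
    using set_dynkin[of _ _ w] that w by (auto intro!: ad_word_closed)
  have "sum_terms L (\<lambda>v. ad_word L y v z) (dynkin (i # w)) =
      sum_terms L (\<lambda>v. y i \<otimes> ad_word L y v z) (dynkin w) \<oplus>
      \<ominus> sum_terms L (\<lambda>v. ad_word L y v (y i \<otimes> z)) (dynkin w)"
    unfolding dynkin_Cons[OF w(1)]
    using yi cl[OF z] cl[OF bracket_closed[OF yi z]] bracket_closed
    by (subst sum_terms_append) (auto simp: sum_terms_map sum_terms_uminus)
  also have "\<dots> = y i \<otimes> (nested L y w \<otimes> z) \<oplus> \<ominus> (nested L y w \<otimes> (y i \<otimes> z))"
    using yi z cl bracket_closed by (simp add: IH bracket_sum_terms)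
  also have "\<dots> = (y i \<otimes> nested L y w) \<otimes> z"
    using yi nested_closed[OF w(2)] z by (rule bracket_bracket_left[symmetric])
  finally show ?case by (simp add: w_def)
qed simp

text \<open>Each word v in the expansion of w yields iv - vi. The words iv contribute
  \<open>length w\<close> copies of the nested bracket by induction. The words vi add up to the
  bracket of \<open>nested L y w\<close> with \<open>y i\<close>, whose negative is one more
  copy.\<close>

lemma dynkin_specht_wever:
  assumes "set w \<subseteq> I"
  shows "sum_terms L (nested L y) (dynkin w) = of_nat (length w) \<odot> nested L y w"
  using assms
proof (induction w rule: induct_list012)
  case 1
  then show ?case using smult_r_null by simp
next
  case (2 i)
  then show ?case using smult_one[of "y i"] by (simp add: gen_closed)
next
  case (3 i j u)
  define w where "w = j # u"
  have w: "w \<noteq> []" "set w \<subseteq> I" "i \<in> I" using 3 by (auto simp: w_def)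
  have IH: "sum_terms L (nested L y) (dynkin w) = of_nat (length w) \<odot> nested L y w"
    using 3 by (simp add: w_def)
  have yi: "y i \<in> carrier L" using w gen_closed by blast
  have nw: "nested L y w \<in> carrier L" by (rule nested_closed[OF w(2)])
  have cl: "\<forall>p\<in>set (dynkin w). nested L y (snd p) \<in> carrier L \<and>
      nested L y (snd p @ [i]) \<in> carrier L \<and> nested L y (i # snd p) \<in> carrier L"
  proof
    fix p assume "p \<in> set (dynkin w)"
    then have "set (snd p) = set w" using set_dynkin[of "fst p" "snd p" w] by simp
    then show "nested L y (snd p) \<in> carrier L \<and>
      nested L y (snd p @ [i]) \<in> carrier L \<and> nested L y (i # snd p) \<in> carrier L"
      using w by (auto intro!: nested_closed)
  qed
  have "sum_terms L (nested L y) (dynkin (i # w)) =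
      sum_terms L (\<lambda>v. nested L y (i # v)) (dynkin w) \<oplus> \<ominus> sum_terms L (\<lambda>v. nested L y (v @ [i])) (dynkin w)"
    unfolding dynkin_Cons[OF w(1)]
    using cl by (subst sum_terms_append) (auto simp: sum_terms_map sum_terms_uminus)
  also have "sum_terms L (\<lambda>v. nested L y (i # v)) (dynkin w) = sum_terms L (\<lambda>v. y i \<otimes> nested L y v) (dynkin w)"
    by (rule sum_terms_cong) (auto simp: nested_Cons dest: dynkin_not_Nil)
  also have "\<dots> = of_nat (length w) \<odot> (y i \<otimes> nested L y w)"
    using yi nw cl by (simp add: IH bracket_smult_right flip: bracket_sum_terms)
  also have "sum_terms L (\<lambda>v. nested L y (v @ [i])) (dynkin w) = nested L y w \<otimes> y i"
    using nested_bracket[OF w(1,2) yi] by (simp add: nested_append)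
  also have "\<ominus> (nested L y w \<otimes> y i) = y i \<otimes> nested L y w"
    using bracket_antisym[OF yi nw] by simp
  also have "of_nat (length w) \<odot> (y i \<otimes> nested L y w) \<oplus> y i \<otimes> nested L y w =
      of_nat (length (i # w)) \<odot> (y i \<otimes> nested L y w)"
    using smult_l_distr[of "of_nat (length w)" 1 "y i \<otimes> nested L y w"] smult_one[of "y i \<otimes> nested L y w"]
      bracket_closed[OF yi nw] by (simp add: add.commute)
  finally show ?case by (simp add: w_def)
qed

text \<open>This is why nested brackets span: a bracket of two of them is a combination of nested
  brackets on rearranged letters.\<close>

lemma nested_bracket_nested:
  assumes "v \<noteq> []" "w \<noteq> []" "set v \<subseteq> I" "set w \<subseteq> I"
  shows "nested L y v \<otimes> nested L y w = sum_terms L (\<lambda>u. nested L y (u @ w)) (dynkin v)"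
  using nested_bracket[OF assms(1,3) nested_closed[OF assms(4)]] assms(2) by (simp add: nested_append)

lemma sum_terms_in_submodule:
  assumes "submodule class_ring N L" "\<forall>p\<in>set xs. g (snd p) \<in> N"
  shows "sum_terms L g xs \<in> N"
  using assms unfolding submodule_def by (induction xs) auto

lemma span_bracket_closed:
  assumes A: "A \<subseteq> carrier L" and B: "B \<subseteq> carrier L" and N: "submodule class_ring N L"
    and AB: "\<And>a b. a \<in> A \<Longrightarrow> b \<in> B \<Longrightarrow> a \<otimes> b \<in> N" and v: "v \<in> span A" and w: "w \<in> span B"
  shows "v \<otimes> w \<in> N"
proof -
  have ND: "\<zero> \<in> N" "\<And>x z. x \<in> N \<Longrightarrow> z \<in> N \<Longrightarrow> x \<oplus> z \<in> N" "\<And>c x. x \<in> N \<Longrightarrow> c \<odot> x \<in> N"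
    using N unfolding submodule_def by auto
  \<comment> \<open>Bilinearity is used one argument at a time: \<open>lin\<close> serves first for
    bracketing with a fixed \<open>b\<close> on the right, then for bracketing with \<open>v\<close>
    on the left.\<close>
  have lin: "\<phi> (lincomb a C) \<in> N"
    if "finite C" "C \<subseteq> carrier L" "\<And>x z. x \<in> carrier L \<Longrightarrow> z \<in> carrier L \<Longrightarrow> \<phi> (x \<oplus> z) = \<phi> x \<oplus> \<phi> z"
      "\<And>c x. x \<in> carrier L \<Longrightarrow> \<phi> (c \<odot> x) = c \<odot> \<phi> x" "\<And>c. c \<in> C \<Longrightarrow> \<phi> c \<in> N" "\<phi> \<zero> = \<zero>" for \<phi> a C
    using that(1,2,5)
  proof (induction C rule: finite_induct)
    case empty
    then show ?case using that(6) ND(1) by simp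
  next
    case (insert x C)
    have "lincomb a (insert x C) = a x \<odot> x \<oplus> lincomb a C"
      using insert unfolding lincomb_def by (subst finsum_insert) auto
    moreover have "lincomb a C \<in> carrier L" "a x \<odot> x \<in> carrier L" using insert by auto
    ultimately show ?case using insert that(3,4) ND by simp
  qed
  have vL: "v \<in> carrier L" using span_is_subset2[OF A] v by blast
  have "v \<otimes> b \<in> N" if "b \<in> B" for b
  proof -
    obtain a C where C: "finite C" "C \<subseteq> A" "v = lincomb a C" using v unfolding span_def by auto
    have b: "b \<in> carrier L" using that B by blast
    have "\<zero> \<otimes> b = \<zero>" using bracket_antisym[of \<zero> b] b by (simp add: bracket_zero_right)
    then show ?thesis unfolding C(3)
      using C A b AB that by (intro lin[of C "\<lambda>x. x \<otimes> b"]) (auto simp: bracket_add_left bracket_smult_left)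
  qed
  moreover obtain a C where C: "finite C" "C \<subseteq> B" "w = lincomb a C" using w unfolding span_def by auto
  ultimately show ?thesis unfolding C(3)
    using C B vL by (intro lin[of C "\<lambda>x. v \<otimes> x"]) (auto simp: bracket_add_right bracket_smult_right bracket_zero_right)
qed

end

section \<open>A representation on noncommutative power series\<close>

text \<open>A function on words stands for the power series in noncommuting variables with these
  coefficients.\<close>

type_synonym word_op = "(nat list \<Rightarrow> rat) \<Rightarrow> nat list \<Rightarrow> rat"

definition linear_op :: "word_op \<Rightarrow> bool" where
  "linear_op F \<longleftrightarrow> (\<forall>f g w. F (\<lambda>v. f v + g v) w = F f w + F g w) \<and> (\<forall>c f w. F (\<lambda>v. c * f v) w = c * F f w)"

definition left_mult :: "nat \<Rightarrow> word_op" where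
  "left_mult i f w = (case w of [] \<Rightarrow> 0 | a # v \<Rightarrow> if a = i then f v else 0)"

definition right_mult :: "nat \<Rightarrow> word_op" where
  "right_mult i f w = (if w \<noteq> [] \<and> last w = i then f (butlast w) else 0)"

definition hd_part :: "nat \<Rightarrow> nat \<Rightarrow> (nat list \<Rightarrow> rat) \<Rightarrow> nat \<Rightarrow> nat list \<Rightarrow> rat" where
  "hd_part i j f a w = (case w of [] \<Rightarrow> 0 | c # v \<Rightarrow>
     if a = i \<and> c = j \<or> a = j \<and> c = i then f (a # v) - f (c # v) else 0)"

text \<open>\<open>twist i j\<close> is the derivation that maps the variable \<open>X\<^sub>i\<close> to \<open>[X\<^sub>i, X\<^sub>j]\<close>, \<open>X\<^sub>j\<close> to
  \<open>[X\<^sub>j, X\<^sub>i]\<close> and the other variables to 0. The summand \<open>hd_part\<close> collects its effect on the first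
  variable of the words; the result has two letters \<open>a\<close>, \<open>c\<close> in the place of that variable.\<close>

primrec twist' :: "nat \<Rightarrow> nat \<Rightarrow> nat list \<Rightarrow> (nat list \<Rightarrow> rat) \<Rightarrow> rat" where
  "twist' i j [] f = 0"
| "twist' i j (a # w) f = twist' i j w (\<lambda>v. f (a # v)) + hd_part i j f a w"

definition twist :: "nat \<Rightarrow> nat \<Rightarrow> word_op" where "twist i j f w = twist' i j w f"

lemma twist_simps [simp]:
  "twist i j f [] = 0"
  "twist i j f (a # w) = twist i j (\<lambda>v. f (a # v)) w + hd_part i j f a w"
  by (simp_all add: twist_def)

lemma hd_part_simps [simp]:
  "hd_part i j f a [] = 0"
  "hd_part i j f a (c # v) = (if a = i \<and> c = j \<or> a = j \<and> c = i then f (a # v) - f (c # v) else 0)"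
  by (simp_all add: hd_part_def)

lemma left_mult_simps [simp]:
  "left_mult i f [] = 0" "left_mult i f (a # v) = (if a = i then f v else 0)"
  by (simp_all add: left_mult_def)

lemma hd_part_linear:
  "hd_part i j (\<lambda>v. f v + g v) a w = hd_part i j f a w + hd_part i j g a w"
  "hd_part i j (\<lambda>v. c * f v) a w = c * hd_part i j f a w"
  "hd_part i j f a w = hd_part j i f a w"
  "hd_part i i f a w = 0"
  by (cases w; simp add: algebra_simps; fail)+

lemma twist_add: "twist i j (\<lambda>v. f v + g v) w = twist i j f w + twist i j g w"
proof (induction w arbitrary: f g)
  case (Cons a w)
  show ?case using Cons.IH[of "\<lambda>v. f (a # v)" "\<lambda>v. g (a # v)"] by (simp add: hd_part_linear(1))
qed simp

lemma twist_scale: "twist i j (\<lambda>v. c * f v) w = c * twist i j f w"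
proof (induction w arbitrary: f)
  case (Cons a w)
  show ?case using Cons.IH[of "\<lambda>v. f (a # v)"] by (simp add: hd_part_linear(2) distrib_left)
qed simp

lemma twist_zero: "twist i j (\<lambda>v. 0) w = 0"
  using twist_scale[of i j 0 "\<lambda>v. 0"] by simp

lemma twist_diff: "twist i j (\<lambda>v. f v - g v) w = twist i j f w - twist i j g w"
  using twist_add[of i j f "\<lambda>v. (-1) * g v" w] twist_scale[of i j "-1" g w] by simp

lemma twist_if: "twist i j (\<lambda>v. if P then f v else g v) w = (if P then twist i j f w else twist i j g w)"
  by simp

lemma twist_self: "twist i i f w = 0"
  by (induction w arbitrary: f) (simp_all add: hd_part_linear(4))

lemma twist_commute: "twist i j = twist j i"
proof -
  have "twist i j f w = twist j i f w" for f w
  proof (induction w arbitrary: f)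
    case (Cons a w)
    then show ?case using hd_part_linear(3)[of i j f a w] by simp
  qed simp
  then show ?thesis by blast
qed

lemma linear_left_mult: "linear_op (left_mult i)"
  by (auto simp: linear_op_def left_mult_def split: list.split)

lemma linear_twist: "linear_op (twist i j)"
  by (auto simp: linear_op_def twist_add twist_scale)

section \<open>Commutators of left multiplications and derivations\<close>

definition comm :: "word_op \<Rightarrow> word_op \<Rightarrow> word_op" where
  "comm F G f w = F (G f) w - G (F f) w"

text \<open>For a derivation D, D(XP) - X D(P) = D(X) P, so the commutator is left multiplication by
  the image of the variable.\<close>

lemma comm_twist_left_mult:
  "comm (twist i j) (left_mult k) f w =
    (if k = i then comm (left_mult i) (left_mult j) f w
     else if k = j then comm (left_mult j) (left_mult i) f w else 0)"
  if "i \<noteq> j"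
proof (cases w)
  case (Cons a v)
  then show ?thesis using that
    by (cases v) (auto simp: comm_def twist_if twist_zero)
qed (simp add: comm_def)

lemma twist_twist_Cons:
  "twist i j (twist k l f) (a # w) = twist i j (twist k l (\<lambda>u. f (a # u))) w
     + twist i j (hd_part k l f a) w + hd_part i j (twist k l f) a w"
  by (simp add: twist_add)

lemma twist_hd_part:
  "twist i j (hd_part k l f a) (c # v) =
    (if a = k \<and> c = l \<or> a = l \<and> c = k
     then twist i j (\<lambda>u. f (a # u)) v - twist i j (\<lambda>u. f (c # u)) v else 0)
    + hd_part i j (hd_part k l f a) c v"
  unfolding twist_simps(2) hd_part_simps(2) twist_if twist_diff twist_zero ..

lemma hd_part_twist:
  "hd_part i j (twist k l f) a (c # v) =
    (if a = i \<and> c = j \<or> a = j \<and> c = i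
     then twist k l (\<lambda>u. f (a # u)) v + hd_part k l f a v
       - twist k l (\<lambda>u. f (c # u)) v - hd_part k l f c v else 0)"
  unfolding twist_simps(2) hd_part_simps(2) by simp

text \<open>Prepares induction on words: the first summand is the commutator on the rest of the
  word, the others collect the cases in which both derivations act on what stems from the first
  variable.\<close>

lemma comm_twist_Cons:
  "comm (twist i j) (twist k l) f (a # c # v) =
    comm (twist i j) (twist k l) (\<lambda>u. f (a # u)) (c # v)
    + (if a = i \<and> c = j \<or> a = j \<and> c = i then hd_part k l f a v - hd_part k l f c v else 0)
    - (if a = k \<and> c = l \<or> a = l \<and> c = k then hd_part i j f a v - hd_part i j f c v else 0)
    + hd_part i j (hd_part k l f a) c v - hd_part k l (hd_part i j f a) c v"
proof -
  \<comment> \<open>\<open>t\<close>, \<open>t'\<close>, \<open>s\<close>, \<open>s'\<close> stand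
    for the mixed terms, with one derivation acting on the first variable and the other on the rest.
    They occur in both orders and cancel.\<close>
  have *: "(x + ((if q then t - t' else 0) + h) + (if p then s + k - s' - k' else 0))
      - (x' + ((if p then s - s' else 0) + h') + (if q then t + m - t' - m' else 0)) =
    (x - x') + (if p then k - k' else 0) - (if q then m - m' else 0) + h - h'"
    for x x' t t' h h' s s' k k' m m' :: rat and p q
    by simp
  show ?thesis
    unfolding comm_def twist_twist_Cons[of _ _ _ _ f a "c # v"] twist_hd_part hd_part_twist
    by (rule *)
qed

lemma comm_twist_disjoint:
  assumes "{i, j} \<inter> {k, l} = {}"
  shows "comm (twist i j) (twist k l) f w = 0"
proof (induction w arbitrary: f)
  case (Cons a w)
  show ?case
  proof (cases w)
    case (Cons c v)
    have "comm (twist i j) (twist k l) (\<lambda>u. f (a # u)) (c # v) = 0"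
      using Cons.IH[of "\<lambda>u. f (a # u)"] Cons by simp
    moreover have "(if a = i \<and> c = j \<or> a = j \<and> c = i then hd_part k l f a v - hd_part k l f c v else 0) = 0"
      "(if a = k \<and> c = l \<or> a = l \<and> c = k then hd_part i j f a v - hd_part i j f c v else 0) = 0"
      "hd_part i j (hd_part k l f a) c v = 0" "hd_part k l (hd_part i j f a) c v = 0"
      using assms by (cases v; simp; blast)+
    ultimately show ?thesis
      unfolding Cons comm_twist_Cons[of _ _ _ _ f a c v] by simp
  qed (simp add: comm_def)
qed (simp add: comm_def)

lemma comm_twist_triangle:
  "comm (twist i j) (twist j l) f w = comm (twist j l) (twist l i) f w"
  if "i \<noteq> j" "j \<noteq> l" "i \<noteq> l"
proof (induction w arbitrary: f)
  case (Cons a w)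
  show ?case
  proof (cases w)
    case (Cons c v)
    have "comm (twist i j) (twist j l) (\<lambda>u. f (a # u)) (c # v) =
        comm (twist j l) (twist l i) (\<lambda>u. f (a # u)) (c # v)"
      using Cons.IH[of "\<lambda>u. f (a # u)"] Cons by simp
    \<comment> \<open>The first variable has been replaced by three letters \<open>a\<close>,
      \<open>c\<close>, \<open>b\<close>, and only their coincidences with \<open>i\<close>,
      \<open>j\<close>, \<open>l\<close> matter.\<close>
    moreover have "(if a = i \<and> c = j \<or> a = j \<and> c = i then hd_part j l f a v - hd_part j l f c v else 0)
        - (if a = j \<and> c = l \<or> a = l \<and> c = j then hd_part i j f a v - hd_part i j f c v else 0)
        + hd_part i j (hd_part j l f a) c v - hd_part j l (hd_part i j f a) c v =
      (if a = j \<and> c = l \<or> a = l \<and> c = j then hd_part l i f a v - hd_part l i f c v else 0)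
        - (if a = l \<and> c = i \<or> a = i \<and> c = l then hd_part j l f a v - hd_part j l f c v else 0)
        + hd_part j l (hd_part l i f a) c v - hd_part l i (hd_part j l f a) c v"
    proof (cases v)
      case (Cons b u)
      consider "a = i" | "a = j" | "a = l" | "a \<noteq> i" "a \<noteq> j" "a \<noteq> l" by blast
      then show ?thesis
      proof cases
        case 1
        then show ?thesis using that not_sym[OF that(1)] not_sym[OF that(2)] not_sym[OF that(3)] Cons
          by (cases "c = j"; cases "c = l"; simp)
      next
        case 2
        then show ?thesis using that not_sym[OF that(1)] not_sym[OF that(2)] not_sym[OF that(3)] Cons
          by (cases "c = i"; cases "c = l"; simp)
      next
        case 3
        then show ?thesis using that not_sym[OF that(1)] not_sym[OF that(2)] not_sym[OF that(3)] Cons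
          by (cases "c = j"; cases "c = i"; simp)
      next
        case 4
        then show ?thesis using Cons by simp
      qed
    qed simp
    moreover have "x + p - q + r - s = y + p' - q' + r' - s'"
      if "x = y" "p - q + r - s = p' - q' + r' - s'" for x y p q r s p' q' r' s' :: rat
      using that by simp
    ultimately show ?thesis
      unfolding Cons comm_twist_Cons[of _ _ _ _ f a c v] by blast
  qed (simp add: comm_def)
qed (simp add: comm_def)

section \<open>The action of the Lie algebra by operators\<close>

definition gen_op :: "nat \<Rightarrow> nat \<times> nat \<Rightarrow> word_op" where
  "gen_op n = (\<lambda>(i, j). if i = n \<and> j = n then (\<lambda>f w. 0) else if i = n then left_mult j
     else if j = n then left_mult i else twist i j)"

primrec rep :: "nat \<Rightarrow> (nat \<times> nat) lie_term \<Rightarrow> word_op" where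
  "rep n (Gen g) = gen_op n g"
| "rep n Zero = (\<lambda>f w. 0)"
| "rep n (Add s t) = (\<lambda>f w. rep n s f w + rep n t f w)"
| "rep n (Scale c t) = (\<lambda>f w. c * rep n t f w)"
| "rep n (Bracket s t) = comm (rep n s) (rep n t)"

lemma linear_opD:
  assumes "linear_op F"
  shows "F (\<lambda>v. f v + g v) w = F f w + F g w" "F (\<lambda>v. c * f v) w = c * F f w"
    "F (\<lambda>v. f v - g v) w = F f w - F g w" "F (\<lambda>v. 0) w = 0"
proof -
  show a: "F (\<lambda>v. f v + g v) w = F f w + F g w" and s: "F (\<lambda>v. c * f v) w = c * F f w" for f g c
    using assms by (simp_all add: linear_op_def)
  show "F (\<lambda>v. f v - g v) w = F f w - F g w"
    using a[of f "\<lambda>v. (-1) * g v"] s[of "-1" g] by simp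
  show "F (\<lambda>v. 0) w = 0" using s[of 0 "\<lambda>v. 0"] by simp
qed

lemma linear_comm:
  assumes "linear_op F" "linear_op G"
  shows "linear_op (comm F G)"
proof -
  have [simp]: "comm F G f = (\<lambda>w. F (G f) w - G (F f) w)" for f by (simp add: comm_def fun_eq_iff)
  have *: "F (\<lambda>v. f v + g v) = (\<lambda>w. F f w + F g w)" "G (\<lambda>v. f v + g v) = (\<lambda>w. G f w + G g w)"
    "F (\<lambda>v. c * f v) = (\<lambda>w. c * F f w)" "G (\<lambda>v. c * f v) = (\<lambda>w. c * G f w)" for f g c
    by (simp_all add: fun_eq_iff linear_opD assms)
  show ?thesis unfolding linear_op_def
    by (simp add: * algebra_simps)
qed

text \<open>Linearity of the operators makes \<open>comm\<close> bilinear and gives the Jacobi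
  identity in \<open>rep_lie_eq\<close>.\<close>

lemma linear_rep: "linear_op (rep n t)"
proof (induction t)
  case (Gen g)
  then show ?case
    by (auto simp: gen_op_def linear_left_mult linear_twist split: prod.split) (simp add: linear_op_def)
next
  case (Bracket s t)
  then show ?case by (simp add: linear_comm)
qed (simp_all add: linear_op_def algebra_simps)

lemma comm_antisym: "comm F G f w = - comm G F f w"
  by (simp add: comm_def)

lemma comm_zero:
  assumes "linear_op F"
  shows "comm F (\<lambda>f w. 0) f w = 0" "comm (\<lambda>f w. 0) F f w = 0"
  by (simp_all add: comm_def linear_opD[OF assms])

lemma gen_op_sym: "gen_op n (i, j) = gen_op n (j, i)"
  by (auto simp: gen_op_def twist_commute)

lemma gen_op_self: "gen_op n (i, i) = (\<lambda>f w. 0)"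
  by (auto simp: gen_op_def twist_self fun_eq_iff)

lemma linear_gen_op: "linear_op (gen_op n g)"
  using linear_rep[of n "Gen g"] by simp

text \<open>At most one of the two pairs contains \<open>n\<close>, so two left multiplications
  never meet, and a derivation meets only variables that it kills.\<close>

lemma comm_gen_op_disjoint:
  assumes "{i, j} \<inter> {k, l} = {}"
  shows "comm (gen_op n (i, j)) (gen_op n (k, l)) f w = 0"
proof -
  have tl: "comm (twist i j) (left_mult k) f w = 0" if "k \<noteq> i" "k \<noteq> j" "i \<noteq> j" for i j k
    using that by (simp add: comm_twist_left_mult)
  then have lt: "comm (left_mult k) (twist i j) f w = 0" if "k \<noteq> i" "k \<noteq> j" "i \<noteq> j" for i j k
    using that comm_antisym[of "left_mult k" "twist i j"] by simp
  show ?thesis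
  proof (cases "i = j \<or> k = l")
    case True
    then show ?thesis by (auto simp: gen_op_self comm_zero linear_gen_op)
  next
    case False
    then show ?thesis using assms tl[of l i j] tl[of k i j] lt[of i k l] lt[of j k l] comm_twist_disjoint[of i j k l]
      by (auto simp: gen_op_def)
  qed
qed

text \<open>For distinct indices other than \<open>n\<close> this is
  \<open>comm_twist_triangle\<close>; if one index is \<open>n\<close>, both sides reduce to
  commutators of left multiplications. The other equality of the relation is a cyclic shift of the
  indices.\<close>

lemma comm_gen_op_triangle:
  "comm (gen_op n (i, j)) (gen_op n (j, l)) f w = comm (gen_op n (j, l)) (gen_op n (l, i)) f w"
proof (cases "i = j \<or> j = l \<or> i = l")
  case True
  have "comm F F f w = 0" for F by (simp add: comm_def)
  then show ?thesis
    using True by (auto simp: gen_op_self comm_zero linear_gen_op gen_op_sym[of n j l] gen_op_sym[of n i j])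
next
  case False
  have lt: "comm (left_mult k) (twist i j) f w = - comm (twist i j) (left_mult k) f w" for i j k
    by (rule comm_antisym)
  show ?thesis using False comm_twist_triangle[of i j l f w] comm_antisym[of "left_mult i" "left_mult j" f w]
     comm_antisym[of "left_mult i" "left_mult l" f w] comm_antisym[of "left_mult j" "left_mult l" f w]
    by (auto simp: gen_op_def lt comm_twist_left_mult)
qed

lemma rep_relations:
  assumes "(s, t) \<in> lie_B_relations n"
  shows "rep n s = rep n t"
  using assms unfolding lie_B_relations_def
  by (auto simp: gen_op_self comm_gen_op_disjoint intro!: gen_op_sym[THEN fun_cong, THEN fun_cong] ext comm_gen_op_triangle)

lemma rep_lie_eq:
  assumes "lie_eq X (lie_B_relations n) s t"
  shows "rep n s = rep n t"
  using assms
proof (induction rule: lie_eq.induct)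
  case (rel s t)
  then show ?case by (simp add: rep_relations)
next
  case (bracket_cong s s' t t')
  then show ?case by simp
next
  case (bracket_add_left s t u)
  show ?case by (simp add: fun_eq_iff comm_def linear_opD[OF linear_rep])
next
  case (bracket_add_right s t u)
  show ?case by (simp add: fun_eq_iff comm_def linear_opD[OF linear_rep])
next
  case (bracket_scale_left s t c)
  show ?case by (simp add: fun_eq_iff comm_def linear_opD[OF linear_rep] algebra_simps)
next
  case (bracket_scale_right s t c)
  show ?case by (simp add: fun_eq_iff comm_def linear_opD[OF linear_rep] algebra_simps)
next
  case (jacobi s t u)
  have *: "comm F G f = (\<lambda>w. F (G f) w - G (F f) w)" for F G f by (simp add: comm_def fun_eq_iff)
  show ?case by (simp add: fun_eq_iff * linear_opD[OF linear_rep])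
qed (simp_all add: fun_eq_iff comm_def algebra_simps)

section \<open>Coefficients of nested brackets, by evaluating at the power series 1\<close>

definition vacuum :: "nat list \<Rightarrow> rat" where "vacuum w = (if w = [] then 1 else 0)"

text \<open>The representative is arbitrary by \<open>rep_lie_eq\<close>.\<close>

definition word_coeff :: "nat \<Rightarrow> nat list \<Rightarrow> (nat \<times> nat) lie_term set \<Rightarrow> rat" where
  "word_coeff n v A = rep n (SOME t. t \<in> A) vacuum v"

lemma word_coeff_class:
  assumes "t \<in> lie_terms X"
  shows "word_coeff n v (lie_class X (lie_B_relations n) t) = rep n t vacuum v"
proof -
  have "t \<in> lie_class X (lie_B_relations n) t"
    using assms by (simp add: lie_class_def lie_rel_def lie_eq.refl)
  then have "(SOME s. s \<in> lie_class X (lie_B_relations n) t) \<in> lie_class X (lie_B_relations n) t"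
    by (rule someI)
  then show ?thesis
    unfolding word_coeff_def by (subst rep_lie_eq[of X n t]) (auto simp: lie_class_def lie_rel_def)
qed

lemma word_coeff_linear:
  assumes "x \<in> carrier (lie_B n)" "y \<in> carrier (lie_B n)"
  shows "word_coeff n v (x \<oplus>\<^bsub>lie_B n\<^esub> y) = word_coeff n v x + word_coeff n v y"
    and "word_coeff n v (c \<odot>\<^bsub>lie_B n\<^esub> x) = c * word_coeff n v x"
  using assms by (auto simp: lie_B_def carrier_presented_lie presented_lie_ops word_coeff_class)

fun nested_term :: "nat \<Rightarrow> nat list \<Rightarrow> (nat \<times> nat) lie_term" where
  "nested_term n [] = Zero"
| "nested_term n [i] = xg i n"
| "nested_term n (i # j # w) = Bracket (xg i n) (nested_term n (j # w))"

lemma right_mult_simps [simp]: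
  "right_mult i f [] = 0" "right_mult i f (v @ [a]) = (if a = i then f v else 0)"
  "right_mult i f [a] = (if a = i then f [] else 0)"
  by (simp_all add: right_mult_def)

lemma left_right_mult: "left_mult i (right_mult j f) = right_mult j (left_mult i f)"
proof
  fix w show "left_mult i (right_mult j f) w = right_mult j (left_mult i f) w"
    by (cases w) (auto simp: right_mult_def butlast.simps)
qed

lemma left_mult_vacuum: "left_mult i vacuum = right_mult i vacuum"
proof
  fix w show "left_mult i vacuum w = right_mult i vacuum w"
    by (cases w) (auto simp: right_mult_def vacuum_def)
qed

text \<open>Nested brackets of the generators with second index \<open>n\<close> act through left
  multiplications, and these commute with right multiplications.\<close>

lemma rep_nested_term_right_mult:
  assumes "set w \<subseteq> {1..<n}"
  shows "rep n (nested_term n w) (right_mult j f) = right_mult j (rep n (nested_term n w) f)"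
  using assms
proof (induction n w arbitrary: f rule: nested_term.induct)
  case (3 n i k w)
  then have i: "i \<noteq> n" and IH: "rep n (nested_term n (k # w)) (right_mult j f) =
      right_mult j (rep n (nested_term n (k # w)) f)" for f by auto
  have diff: "right_mult j (\<lambda>v. f v - g v) x = right_mult j f x - right_mult j g x" for f g x
    by (simp add: right_mult_def)
  have comm: "comm F G f = (\<lambda>x. F (G f) x - G (F f) x)" for F G f
    by (simp add: comm_def fun_eq_iff)
  show ?case
    by (rule ext) (simp add: comm diff IH gen_op_def i left_right_mult)
qed (auto simp: gen_op_def left_right_mult fun_eq_iff right_mult_def)

lemma dynkin_coeff_Cons:
  assumes "w \<noteq> []"
  shows "dynkin_coeff (a # w) v = left_mult a (dynkin_coeff w) v - right_mult a (dynkin_coeff w) v"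
proof -
  let ?c = "\<lambda>v (s, u). if u = v then s else 0"
  have 1: "sum_list (map (?c v) (map (\<lambda>(s, v). (s, a # v)) xs)) =
      left_mult a (\<lambda>v. sum_list (map (?c v) xs)) v" for xs :: "(rat \<times> nat list) list"
    by (cases v; induction xs) auto
  have 2: "sum_list (map (?c v) (map (\<lambda>(s, v). (- s, v @ [a])) xs)) =
      - right_mult a (\<lambda>v. sum_list (map (?c v) xs)) v" for xs :: "(rat \<times> nat list) list"
    by (cases v rule: rev_cases; induction xs) auto
  show ?thesis
    unfolding dynkin_coeff_def dynkin_Cons[OF assms] map_append sum_list_append 1 2 by simp
qed

text \<open>If P is the operator of the shorter bracket, its commutator with
  \<open>left_mult i\<close> has to be evaluated at 1. There \<open>left_mult i\<close> agrees with
  \<open>right_mult i\<close>, which moves past P. The result is the recursion of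
  \<open>dynkin\<close>.\<close>

lemma rep_nested_term_vacuum:
  assumes "set w \<subseteq> {1..<n}" "w \<noteq> []"
  shows "rep n (nested_term n w) vacuum = dynkin_coeff w"
  using assms
proof (induction n w rule: nested_term.induct)
  case (2 n i)
  then have "i \<noteq> n" by auto
  show ?case
  proof
    fix v show "rep n (nested_term n [i]) vacuum v = dynkin_coeff [i] v"
      using \<open>i \<noteq> n\<close> by (cases v) (auto simp: gen_op_def dynkin_coeff_def vacuum_def)
  qed
next
  case (3 n i k w)
  then have i: "i \<noteq> n" and IH: "rep n (nested_term n (k # w)) vacuum = dynkin_coeff (k # w)" by auto
  have "rep n (nested_term n (k # w)) (right_mult i vacuum) = right_mult i (dynkin_coeff (k # w))"
    using rep_nested_term_right_mult[of "k # w" n i vacuum] 3 IH by simp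
  then show ?case
    by (intro ext) (simp add: comm_def gen_op_def i IH left_mult_vacuum dynkin_coeff_Cons)
qed simp

section \<open>The Euler characteristic\<close>

lemma bracket_of_nested:
  assumes "w \<noteq> []" "set w \<subseteq> I"
  shows "bracket_of L y I (nested L y w) (mset w)"
  using assms
proof (induction w rule: induct_list012)
  case (2 i)
  then show ?case by (simp add: bracket_of.single)
next
  case (3 i j w)
  have "bracket_of L y I (y i \<otimes>\<^bsub>L\<^esub> nested L y (j # w)) ({#i#} + mset (j # w))"
    using 3 by (intro bracket_of.intros) auto
  then show ?case by (simp add: add_mset_commute)
qed simp

context rat_lie_algebra
begin

text \<open>Rewriting into nested brackets only rearranges letters. Keeping track of
  \<open>m\<close> preserves both the degree and the set of letters, on which
  \<open>M_brackets\<close> depends.\<close>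

lemma bracket_of_in_span:
  assumes "bracket_of L y I v m"
  shows "m \<noteq> {#} \<and> set_mset m \<subseteq> I \<and> v \<in> span (nested L y ` {w. mset w = m})"
  using assms
proof (induction rule: bracket_of.induct)
  case (single i)
  have "{w. mset w = {#i#}} = {[i]}" by auto
  then show ?case using single in_own_span[of "{y i}"] gen_closed by auto
next
  case (bracket v m w m')
  let ?S = "\<lambda>m. nested L y ` {w. mset w = m}"
  have carrier: "?S k \<subseteq> carrier L" if "set_mset k \<subseteq> I" for k
    using that by (auto intro!: nested_closed)
  have sub: "?S (m + m') \<subseteq> carrier L" using bracket by (intro carrier) auto
  have "v \<otimes> w \<in> span (?S (m + m'))"
  proof (rule span_bracket_closed[where A = "?S m" and B = "?S m'"])
    show "submodule class_ring (span (?S (m + m'))) L" by (rule span_is_submodule[OF sub])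
    fix a b assume "a \<in> ?S m" "b \<in> ?S m'"
    then obtain s t where st: "mset s = m" "a = nested L y s" "mset t = m'" "b = nested L y t" by auto
    then have ne: "s \<noteq> []" "t \<noteq> []" and I: "set s \<subseteq> I" "set t \<subseteq> I"
      using bracket.IH by (auto simp flip: set_mset_mset)
    have "nested L y (snd p @ t) \<in> span (?S (m + m'))" if "p \<in> set (dynkin s)" for p
    proof -
      have "mset (snd p) = m" using that mset_dynkin[of "fst p" "snd p" s] st by simp
      then show ?thesis using st by (intro subsetD[OF in_own_span[OF sub]]) auto
    qed
    then show "a \<otimes> b \<in> span (?S (m + m'))"
      unfolding st nested_bracket_nested[OF ne I]
      by (intro sum_terms_in_submodule span_is_submodule[OF sub]) auto
  qed (use bracket carrier in auto)
  then show ?case using bracket by auto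
qed

end

lemma rat_lie_algebra_lie_B: "rat_lie_algebra (lie_B n) (\<lambda>i. x_class n i n) {1..<n}"
proof -
  interpret lie_algebra class_ring "lie_B n" by (rule lie_algebra_lie_B)
  show ?thesis
    by unfold_locales (auto simp: x_class_def lie_B_def carrier_presented_lie)
qed

abbreviation nested_x :: "nat \<Rightarrow> nat list \<Rightarrow> (nat \<times> nat) lie_term set" where
  "nested_x n \<equiv> nested (lie_B n) (\<lambda>i. x_class n i n)"

lemma M_space_eq_span:
  assumes "d > 0"
  shows "M_space d n = LinearCombinations.module.span class_ring (lie_B n)
    (nested_x n ` {w. length w = d \<and> set w = {1..<n}})"
proof -
  interpret rat_lie_algebra "lie_B n" "\<lambda>i. x_class n i n" "{1..<n}"
    by (rule rat_lie_algebra_lie_B)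
  let ?W = "{w. length w = d \<and> set w = {1..<n}}"
  have WC: "nested_x n ` ?W \<subseteq> carrier (lie_B n)" by (auto intro!: nested_closed)
  show ?thesis unfolding M_space_def
  proof
    have "nested_x n ` ?W \<subseteq> M_brackets d n"
    proof clarify
      fix w assume w: "d = length w" "set w = {1..<n}"
      then have "bracket_of (lie_B n) (\<lambda>i. x_class n i n) {1..<n} (nested_x n w) (mset w)"
        using assms by (intro bracket_of_nested) auto
      then show "nested_x n w \<in> M_brackets (length w) n" using w unfolding M_brackets_def by auto
    qed
    then show "span (nested_x n ` ?W) \<subseteq> span (M_brackets d n)" by (rule span_is_monotone)
    have "M_brackets d n \<subseteq> span (nested_x n ` ?W)"
    proof
      fix v assume "v \<in> M_brackets d n"
      then obtain m where m: "bracket_of (lie_B n) (\<lambda>i. x_class n i n) {1..<n} v m"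
        "size m = d" "set_mset m = {1..<n}" unfolding M_brackets_def by auto
      have "nested_x n ` {w. mset w = m} \<subseteq> nested_x n ` ?W"
        using m by (auto simp flip: set_mset_mset size_mset)
      then have "span (nested_x n ` {w. mset w = m}) \<subseteq> span (nested_x n ` ?W)"
        by (rule span_is_monotone)
      moreover have "v \<in> span (nested_x n ` {w. mset w = m})"
        using bracket_of_in_span[OF m(1)] by (elim conjE)
      ultimately show "v \<in> span (nested_x n ` ?W)" by (rule subsetD)
    qed
    then show "span (M_brackets d n) \<subseteq> span (nested_x n ` ?W)"
      by (rule span_is_subset) (rule span_is_submodule[OF WC])
  qed
qed

lemma nested_x_eq_class:
  assumes "set w \<subseteq> {1..<n}"
  shows "nested_term n w \<in> lie_terms ({1..n} \<times> {1..n}) \<and>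
    nested_x n w = lie_class ({1..n} \<times> {1..n}) (lie_B_relations n) (nested_term n w)"
  using assms
  by (induction w rule: induct_list012)
     (auto simp: x_class_def lie_B_def presented_lie_ops zero_presented_lie)

lemma word_coeff_nested_x:
  assumes "set w \<subseteq> {1..<n}" "w \<noteq> []"
  shows "word_coeff n v (nested_x n w) = dynkin_coeff w v"
  using nested_x_eq_class[OF assms(1)] rep_nested_term_vacuum[OF assms]
  by (simp add: word_coeff_class)

text \<open>This is \<open>dim_eq_trace\<close> with factor \<open>d\<close>: its hypothesis
  \<open>key\<close> is the Dynkin-Specht-Wever identity, and the functionals are the word
  coefficients, which are well defined thanks to the representation.\<close>

lemma M_dim_eq_trace:
  assumes d: "d > 0"
  shows "of_nat d * of_nat (M_dim d n) = (\<Sum>w | length w = d \<and> set w = {1..<n}. dynkin_coeff w w)"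
proof -
  interpret L: rat_lie_algebra "lie_B n" "\<lambda>i. x_class n i n" "{1..<n}"
    by (rule rat_lie_algebra_lie_B)
  let ?V = "(lie_B n)\<lparr>carrier := M_space d n\<rparr>"
  interpret V: vectorspace class_ring ?V
    by (rule L.subspace_is_vs[OF subspace_M_space])
  interpret V: field_vectorspace ?V by unfold_locales
  define W where "W = {w. length w = d \<and> set w = {1..<n}}"
  have W: "w \<noteq> []" "set w \<subseteq> {1..<n}" "length w = d" if "w \<in> W" for w
    using that d by (auto simp: W_def)
  have fin: "finite W"
    by (rule finite_subset[OF _ finite_lists_length_eq[of "{1..<n}" d]]) (auto simp: W_def)
  have WC: "nested_x n ` W \<subseteq> carrier (lie_B n)" by (auto simp: W_def intro!: L.nested_closed)
  have M: "M_space d n = L.span (nested_x n ` W)"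
    using M_space_eq_span[OF d] by (simp add: W_def)
  have sub: "nested_x n ` W \<subseteq> M_space d n" unfolding M by (rule L.in_own_span[OF WC])
  have subm: "submodule class_ring (M_space d n) (lie_B n)"
    unfolding M by (rule L.span_is_submodule[OF WC])
  then have MC: "M_space d n \<subseteq> carrier (lie_B n)" by (rule submodule.subset)
  have "of_nat d * of_nat V.dim = (\<Sum>w\<in>W. word_coeff n w (nested_x n w))"
  proof (rule V.dim_eq_trace)
    show "V.fin_dim" by (rule fin_dim_M_space)
    show "V.span (nested_x n ` W) = carrier ?V"
      using L.span_li_not_depend(1)[OF sub subm] M by simp
    show "functional ?V (word_coeff n w)" for w
      using MC word_coeff_linear by (auto simp: functional_def subset_eq)
  next
    fix \<psi> w assume \<psi>: "functional ?V \<psi>" and w: "w \<in> W"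
    \<comment> \<open>\<open>W\<close> is closed under rearrangement, so the whole expansion of
      \<open>w\<close> stays in it.\<close>
    have dW: "v \<in> W" if "mset v = mset w" for v
      using that w by (auto simp: W_def dest: mset_eq_setD mset_eq_length)
    have "(\<Sum>v\<in>W. word_coeff n v (nested_x n w) * \<psi> (nested_x n v)) =
        (\<Sum>v\<in>W. dynkin_coeff w v * \<psi> (nested_x n v))"
      using W[OF w] by (simp add: word_coeff_nested_x)
    also have "\<dots> = (\<Sum>(s, v)\<leftarrow>dynkin w. s * \<psi> (nested_x n v))"
      using fin dW by (rule sum_dynkin_coeff)
    also have "\<dots> = \<psi> (sum_terms ?V (nested_x n) (dynkin w))"
    proof (rule V.functional_sum_terms[OF \<psi>, symmetric], rule ballI)
      fix p assume "p \<in> set (dynkin w)"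
      then have "snd p \<in> W" using dW mset_dynkin[of "fst p" "snd p" w] by simp
      then show "nested_x n (snd p) \<in> carrier ?V" using sub by auto
    qed
    also have "\<dots> = \<psi> (of_nat d \<odot>\<^bsub>lie_B n\<^esub> nested_x n w)"
      using L.dynkin_specht_wever[OF W(2)[OF w]] W(3)[OF w] by (simp add: sum_terms_carrier_update)
    also have "\<dots> = of_nat d * \<psi> (nested_x n w)"
      using \<psi> sub w by (auto simp: functional_def)
    finally show "(\<Sum>v\<in>W. word_coeff n v (nested_x n w) * \<psi> (nested_x n v)) = of_nat d * \<psi> (nested_x n w)" .
  qed (use fin sub in auto)
  also have "\<dots> = (\<Sum>w\<in>W. dynkin_coeff w w)"
    using W by (intro sum.cong) (auto simp: word_coeff_nested_x)
  finally show ?thesis unfolding M_dim_def W_def .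
qed

lemma M_dim_eq_0:
  assumes "M_space d n = {\<zero>\<^bsub>lie_B n\<^esub>}"
  shows "M_dim d n = 0"
proof -
  interpret L: lie_algebra class_ring "lie_B n" by (rule lie_algebra_lie_B)
  interpret V: vectorspace class_ring "(lie_B n)\<lparr>carrier := M_space d n\<rparr>"
    by (rule L.subspace_is_vs[OF subspace_M_space])
  have "V.gen_set {\<zero>\<^bsub>lie_B n\<^esub>}"
    using V.in_own_span[of "{\<zero>\<^bsub>lie_B n\<^esub>}"] V.span_is_subset2[of "{\<zero>\<^bsub>lie_B n\<^esub>}"] assms by auto
  then show ?thesis unfolding M_dim_def using V.dim0I by simp
qed

theorem theorem4p7:
  fixes d :: nat
  assumes "d > 2"
  shows "M_euler_char d = 0"
proof -
  \<comment> \<open>Zero spaces have dimension 0, so the sum may run over a fixed range.\<close>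
  have "M_euler_char d = (\<Sum>n\<in>{1..d + 1}. (-1) ^ n * int (M_dim d n))"
    unfolding M_euler_char_def
  proof (rule sum.mono_neutral_left)
    show "{n. n \<ge> 1 \<and> M_space d n \<noteq> {\<zero>\<^bsub>lie_B n\<^esub>}} \<subseteq> {1..d + 1}"
      using M_eq_zero[of d] by force
  qed (auto simp: M_dim_eq_0)
  \<comment> \<open>The shift \<open>n = k + 1\<close> makes the alphabet \<open>{1..<n}\<close>
    equal to \<open>{1..k}\<close>, at the cost of a global sign.\<close>
  also have "\<dots> = (\<Sum>k\<le>d. (-1) ^ Suc k * int (M_dim d (Suc k)))"
    by (rule sum.reindex_bij_witness[where i = Suc and j = "\<lambda>n. n - 1"]) auto
  \<comment> \<open>The factor \<open>d\<close> turns each dimension into a trace; it is cancelled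
    at the end.\<close>
  finally have "of_nat d * of_int (M_euler_char d) =
      (\<Sum>k\<le>d. (-1) ^ Suc k * (of_nat d * of_nat (M_dim d (Suc k))) :: rat)"
    by (simp add: sum_distrib_left mult.left_commute flip: sum_negf)
  also have "\<dots> = - (\<Sum>k\<le>d. (-1) ^ k * (\<Sum>w | length w = d \<and> set w = {1..k}. dynkin_coeff w w))"
    using assms by (subst M_dim_eq_trace) (simp_all add: atLeastLessThanSuc_atLeastAtMost sum_negf)
  also have "\<dots> = 0" using alternating_sum_dynkin_trace[OF assms] by simp
  finally show ?thesis using assms by simp
qed

end
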